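(* Let $n\ge 1$, let $-1=x_0<x_1<\dots<x_{n+1}=1$ be arbitrary mesh points, $\tau_j=(x_{j-1},x_j)$ for $1\le j\le n+1$, and let $c$ be piecewise constant and perfectly oscillating between two positive values $c_0,c_1$, i.e. $c|_{\tau_j}=c_0$ if $j$ is odd and $c|_{\tau_j}=c_1$ if $j$ is even, with $0<c_{\min}=\min\{c_0,c_1\}\le\max\{c_0,c_1\}=c_{\max}<\infty$. Let $\omega\ge\omega_0>0$, $g_1,g_2\in\mathbb{C}$, and let $u$ be the (weak) solution of $$-u''-\left(\tfrac{\omega}{c}\right)^2u=0\ \text{ in }\Omega=(-1,1),$$ with boundary conditions $$-u'-\mathrm{i}\tfrac{\omega}{c}u=g_1\ \text{ at }x=-1,\qquad u'-\mathrm{i}\tfrac{\omega}{c}u=g_2\ \text{ at }x=1,$$ where $c$ at $x=-1$ (resp. $x=1$) denotes the constant value of $c$ on $\tau_1$ (resp. $\tau_{n+1}$). Then $u$ satisfies $$\left(\int_\Omega |u'|^2+\left(\tfrac{\omega}{c}\right)^2|u|^2\right)^{1/2}\le C_{\mathrm{stab}}\max\{|g_1|,|g_2|\},\qquad C_{\mathrm{stab}}\le C_q\,\alpha_q^{-\omega/c_{\min}},$$ for some $0<\alpha_q<1$ and $C_q\in\mathbb{R}$ depending only on $q:=\frac{c_{\max}-c_{\min}}{c_{\max}+c_{\min}}$; in particular the estimate is independent of the number $n$ of jumps of $c$ (and of the positions of the jump points), and no periodicity of $c$ is required.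
   Context: The weak solution is $u\in H^1(\Omega)$ (complex valued) with $$\int_\Omega\left(u'\bar v'-\left(\tfrac{\omega}{c}\right)^2u\bar v\right)-\mathrm{i}\sum_{x\in\{-1,1\}}\tfrac{\omega}{c(x)}u(x)\bar v(x)=g_1\bar v(-1)+g_2\bar v(1)\qquad\forall v\in H^1(\Omega).$$ The weak problem has a unique solution. *)

theory Defs
  imports "HOL-Analysis.Analysis"
begin

abbreviation Omega :: "real set" where
  "Omega \<equiv> {-1<..<1}"

definition smooth :: "(real \<Rightarrow> real) \<Rightarrow> bool" where
  "smooth \<phi> \<longleftrightarrow> (\<forall>k x. (deriv ^^ k) \<phi> differentiable (at x))"

(* Real-valued test functions suffice for complex-valued u: the integral identity defining the
   weak derivative is complex linear in the test function. *)
definition test_function :: "(real \<Rightarrow> real) \<Rightarrow> bool" where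
  "test_function \<phi> \<longleftrightarrow> smooth \<phi> \<and>
     compact (closure {x. \<phi> x \<noteq> 0}) \<and> closure {x. \<phi> x \<noteq> 0} \<subseteq> Omega"

definition L2 :: "(real \<Rightarrow> complex) set" where
  "L2 = {u. u \<in> borel_measurable (lebesgue_on Omega) \<and>
            integrable (lebesgue_on Omega) (\<lambda>x. (cmod (u x))\<^sup>2)}"

definition has_weak_deriv :: "(real \<Rightarrow> complex) \<Rightarrow> (real \<Rightarrow> complex) \<Rightarrow> bool" where
  "has_weak_deriv u g \<longleftrightarrow> u \<in> L2 \<and> g \<in> L2 \<and>
     (\<forall>\<phi>. test_function \<phi> \<longrightarrow>
        (LINT x|lebesgue_on Omega. deriv \<phi> x *\<^sub>R u x) =
        - (LINT x|lebesgue_on Omega. \<phi> x *\<^sub>R g x))"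

(* Elements of H1 are arbitrary representatives of the almost-everywhere classes; only their
   values on Omega matter. *)
definition H1 :: "(real \<Rightarrow> complex) set" where
  "H1 = {u. \<exists>g. has_weak_deriv u g}"

(* Unique up to a null set. *)
definition weak_deriv :: "(real \<Rightarrow> complex) \<Rightarrow> real \<Rightarrow> complex" where
  "weak_deriv u = (SOME g. has_weak_deriv u g)"

(* Point evaluation u(x) for u in H1 and x in the closed interval is the value at x of the
   continuous representative of u (which exists by the one-dimensional Sobolev embedding and is
   unique on the closed interval). *)
definition trace :: "(real \<Rightarrow> complex) \<Rightarrow> real \<Rightarrow> complex" where
  "trace u = (SOME w. continuous_on {-1..1} w \<and> (AE x in lebesgue_on Omega. w x = u x))"

definition weak_solution ::
  "real \<Rightarrow> (real \<Rightarrow> real) \<Rightarrow> complex \<Rightarrow> complex \<Rightarrow> (real \<Rightarrow> complex) \<Rightarrow> bool" where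
  "weak_solution \<omega> c g1 g2 u \<longleftrightarrow> u \<in> H1 \<and>
     (\<forall>v\<in>H1.
        (LINT x|lebesgue_on Omega.
           weak_deriv u x * cnj (weak_deriv v x) - of_real ((\<omega> / c x)\<^sup>2) * u x * cnj (v x))
        - \<i> * (\<Sum>x\<in>{-1, 1}. of_real (\<omega> / c x) * trace u x * cnj (trace v x))
        = g1 * cnj (trace v (-1)) + g2 * cnj (trace v 1))"

definition energy_norm :: "real \<Rightarrow> (real \<Rightarrow> real) \<Rightarrow> (real \<Rightarrow> complex) \<Rightarrow> real" where
  "energy_norm \<omega> c u =
     sqrt (LINT x|lebesgue_on Omega. (cmod (weak_deriv u x))\<^sup>2 + (\<omega> / c x)\<^sup>2 * (cmod (u x))\<^sup>2)"

definition mesh :: "nat \<Rightarrow> (nat \<Rightarrow> real) \<Rightarrow> bool" where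
  "mesh n x \<longleftrightarrow> x 0 = -1 \<and> x (n + 1) = 1 \<and> (\<forall>j\<in>{1..n + 1}. x (j - 1) < x j)"

(* At the two end points c takes its value on the adjacent subinterval; at the interior mesh
   points, a null set, c is arbitrary. *)
definition oscillating ::
  "nat \<Rightarrow> (nat \<Rightarrow> real) \<Rightarrow> real \<Rightarrow> real \<Rightarrow> (real \<Rightarrow> real) \<Rightarrow> bool" where
  "oscillating n x c0 c1 c \<longleftrightarrow>
     (\<forall>j\<in>{1..n + 1}. \<forall>t\<in>{x (j - 1)<..<x j}. c t = (if odd j then c0 else c1)) \<and>
     c (-1) = c0 \<and> c 1 = (if odd (n + 1) then c0 else c1)"

end

theory Submission
  imports Defs
begin

text \<open>
  A weak solution \<open>u\<close> is \<open>C\<^sup>1\<close> and solves the equation classically off the mesh. The energy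
  \<open>|u'|\<^sup>2 + (\<omega> / c)\<^sup>2 |u|\<^sup>2\<close> is conserved on each subinterval but may jump at every mesh point, which would cost
  a factor per jump. With the largest wave number \<open>\<kappa> = \<omega> / cmin\<close> in place of \<open>\<omega> / c\<close> the energy is continuous,
  and \<open>E' = 2 (\<kappa>\<^sup>2 - (\<omega> / c)\<^sup>2) Re (u' cnj u) \<le> \<kappa> E\<close>, so Gronwall's inequality gives
  \<open>E(x) \<le> exp (2 \<kappa>) E(-1)\<close> irrespective of the number of jumps. Testing the equation with \<open>u\<close> and
  taking imaginary parts bounds \<open>u(-1)\<close> by the data, and the boundary condition at \<open>-1\<close> then bounds \<open>u'(-1)\<close>.
  Hence \<open>\<alpha>q = exp (-1)\<close> works for every \<open>q\<close>.
\<close>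

subsection \<open>Bump functions\<close>

text \<open>Differentiating \<open>exp (- 1 / x)\<close> only produces polynomials in
  \<open>1 / x\<close> as factors. Carrying the polynomial as a parameter makes the family closed
  under differentiation; \<open>flat 1\<close> is the standard smooth function that is flat at
  0.\<close>

definition flat :: "real poly \<Rightarrow> real \<Rightarrow> real" where
  "flat p x = (if x > 0 then poly p (1 / x) * exp (- 1 / x) else 0)"

text \<open>The power \<open>y ^ k\<close> makes the induction go through, since each coefficient of
  the polynomial moves one factor \<open>y\<close> into it. The case \<open>k = 1\<close> later
  absorbs the denominator of the difference quotient at 0.\<close>

lemma poly_times_exp_tendsto_0:
  "((\<lambda>y. poly p y * y ^ k * exp (- y)) \<longlongrightarrow> (0::real)) at_top"
proof (induction p arbitrary: k)
  case 0
  then show ?case by simp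
next
  case (pCons a p)
  have "((\<lambda>y. a * (y ^ k / exp y) + poly p y * y ^ Suc k * exp (- y)) \<longlongrightarrow> a * 0 + 0) at_top"
    by (intro tendsto_intros tendsto_power_div_exp_0 pCons.IH)
  then show ?case
    by (simp add: algebra_simps exp_minus divide_inverse)
qed

text \<open>With \<open>y = 1 / x\<close>, d/dx is \<open>- y^2\<close> times d/dy, which sends
  \<open>p(y) exp (- y)\<close> to \<open>y^2 (p(y) - p'(y)) exp (- y)\<close>. At 0 exponential
  decay beats every polynomial.\<close>

lemma flat_has_derivative:
  "(flat p has_real_derivative flat ([:0, 0, 1:] * (p - pderiv p)) x) (at x)"
proof -
  consider "x > 0" | "x < 0" | "x = 0" by linarith
  then show ?thesis
  proof cases
    case 1
    have "((\<lambda>x. poly p (1 / x) * exp (- 1 / x)) has_real_derivative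
        flat ([:0, 0, 1:] * (p - pderiv p)) x) (at x)"
      using 1 unfolding flat_def
      by (auto intro!: derivative_eq_intros simp: field_simps power2_eq_square)
    then show ?thesis
      by (rule has_field_derivative_transform_within_open[where S = "{0<..}"])
        (use 1 in \<open>auto simp: flat_def\<close>)
  next
    case 2
    have "((\<lambda>x. 0) has_real_derivative 0) (at x)" by simp
    then have "(flat p has_real_derivative 0) (at x)"
      by (rule has_field_derivative_transform_within_open[where S = "{..<0}"])
        (use 2 in \<open>auto simp: flat_def\<close>)
    then show ?thesis using 2 by (simp add: flat_def)
  next
    case 3
    have "((\<lambda>y. flat p y / y) \<longlongrightarrow> 0) (at_right 0)"
    proof -
      have "((\<lambda>y. poly p (inverse y) * (inverse y) ^ 1 * exp (- inverse y)) \<longlongrightarrow> 0) (at_right (0::real))"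
        by (rule filterlim_compose[OF poly_times_exp_tendsto_0 filterlim_inverse_at_top_right])
      moreover have "\<forall>\<^sub>F y in at_right 0.
          poly p (inverse y) * (inverse y) ^ 1 * exp (- inverse y) = flat p y / y"
        by (auto simp: eventually_at_filter flat_def field_simps)
      ultimately show ?thesis
        by (rule Lim_transform_eventually)
    qed
    moreover have "((\<lambda>y. flat p y / y) \<longlongrightarrow> 0) (at_left 0)"
      by (rule tendsto_eventually) (auto simp: eventually_at_filter flat_def)
    ultimately have "((\<lambda>y. flat p y / y) \<longlongrightarrow> 0) (at 0)"
      by (simp add: filterlim_split_at)
    then show ?thesis
      using 3 by (simp add: has_field_derivative_iff flat_def)
  qed
qed

text \<open>A class of functions that visibly contains its derivatives, hence consists of smooth functions.\<close>
inductive flat_algebra :: "(real \<Rightarrow> real) \<Rightarrow> bool" where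
  flat: "flat_algebra (\<lambda>x. flat p (a * x + b))"
| const: "flat_algebra (\<lambda>x. c)"
| add: "flat_algebra f \<Longrightarrow> flat_algebra g \<Longrightarrow> flat_algebra (\<lambda>x. f x + g x)"
| mult: "flat_algebra f \<Longrightarrow> flat_algebra g \<Longrightarrow> flat_algebra (\<lambda>x. f x * g x)"

lemma flat_algebra_derivative:
  assumes "flat_algebra f"
  shows "\<exists>f'. flat_algebra f' \<and> (\<forall>x. (f has_real_derivative f' x) (at x))"
  using assms
proof induction
  case (flat p a b)
  let ?q = "[:0, 0, 1:] * (p - pderiv p)"
  have "((\<lambda>x. flat p (a * x + b)) has_real_derivative flat ?q (a * x + b) * a) (at x)" for x
    by (rule DERIV_chain2[where f = "flat p" and g = "\<lambda>x. a * x + b", OF flat_has_derivative])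
      (auto intro!: derivative_eq_intros)
  then show ?case
    by (intro exI[of _ "\<lambda>x. flat ?q (a * x + b) * a"] conjI allI
        flat_algebra.mult flat_algebra.flat flat_algebra.const)
next
  case (const c)
  have "((\<lambda>x. c) has_real_derivative 0) (at x)" for x by simp
  then show ?case by (intro exI[of _ "\<lambda>x. 0"] conjI allI flat_algebra.const)
next
  case (add f g)
  then obtain f' g' where "flat_algebra f'" "flat_algebra g'"
    "\<And>x. (f has_real_derivative f' x) (at x)" "\<And>x. (g has_real_derivative g' x) (at x)" by blast
  then show ?case
    by (intro exI[of _ "\<lambda>x. f' x + g' x"]) (auto intro!: flat_algebra.add derivative_intros)
next
  case (mult f g)
  then obtain f' g' where "flat_algebra f'" "flat_algebra g'"
    "\<And>x. (f has_real_derivative f' x) (at x)" "\<And>x. (g has_real_derivative g' x) (at x)" by blast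
  then show ?case
    using mult.hyps by (intro exI[of _ "\<lambda>x. f' x * g x + g' x * f x"])
      (auto intro!: flat_algebra.add flat_algebra.mult DERIV_mult)
qed

lemma flat_algebra_deriv_funpow: "flat_algebra f \<Longrightarrow> flat_algebra ((deriv ^^ k) f)"
proof (induction k)
  case (Suc k)
  then obtain f' where f': "flat_algebra f'" "\<And>x. ((deriv ^^ k) f has_real_derivative f' x) (at x)"
    using flat_algebra_derivative by blast
  then have "(deriv ^^ Suc k) f = f'" by (auto intro!: ext DERIV_imp_deriv)
  then show ?case using f' by simp
qed simp

lemma flat_algebra_differentiable: "flat_algebra f \<Longrightarrow> f differentiable (at x)"
  using flat_algebra_derivative real_differentiable_def by blast

lemma flat_algebra_continuous_on: "flat_algebra f \<Longrightarrow> continuous_on S f"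
  by (meson continuous_at_imp_continuous_on differentiable_imp_continuous_within
      flat_algebra_differentiable)

lemma smooth_flat_algebra: "flat_algebra f \<Longrightarrow> smooth f"
  unfolding smooth_def using flat_algebra_deriv_funpow flat_algebra_differentiable by blast

text \<open>Integrals of bumps are not visibly members of \<open>flat_algebra\<close>, but all their
  derivatives from the first on are; order 0 is covered by the assumed derivative.\<close>

lemma smooth_antiderivative:
  assumes "flat_algebra h" and "\<And>x. (f has_real_derivative h x) (at x)"
  shows "smooth f"
proof -
  have "deriv f = h" using assms(2) by (auto intro!: ext DERIV_imp_deriv)
  then have "(deriv ^^ Suc k) f = (deriv ^^ k) h" for k
    by (metis comp_apply funpow_Suc_right)
  then have "(deriv ^^ k) f differentiable (at x)" for k x
    using assms flat_algebra_deriv_funpow flat_algebra_differentiable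
    by (cases k) (auto simp: real_differentiable_def simp del: funpow.simps(2))
  then show ?thesis by (simp add: smooth_def)
qed

lemma test_functionI:
  assumes "smooth \<phi>" and "\<And>x. x \<notin> {s..t} \<Longrightarrow> \<phi> x = 0" and "-1 < s" "t < 1"
  shows "test_function \<phi>"
proof -
  have "closure {x. \<phi> x \<noteq> 0} \<subseteq> {s..t}"
    using assms(2) by (intro closure_minimal) blast+
  moreover from this have "compact (closure {x. \<phi> x \<noteq> 0})"
    using bounded_subset[OF bounded_closed_interval] by (auto simp: compact_eq_bounded_closed)
  moreover have "{s..t} \<subseteq> Omega" using assms by auto
  ultimately show ?thesis
    using assms(1) by (simp add: test_function_def subset_trans)
qed

text \<open>The product confines the support to the interval from \<open>a\<close> to
  \<open>b\<close>. The factor \<open>Suc m\<close> is positive for every \<open>m\<close> and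
  steepens the flanks, so that bumps approximate the indicator.\<close>

definition bump :: "real \<Rightarrow> real \<Rightarrow> nat \<Rightarrow> real \<Rightarrow> real" where
  "bump a b m x = flat 1 (real (Suc m) * (x - a)) * flat 1 (real (Suc m) * (b - x))"

lemma flat_algebra_bump: "flat_algebra (bump a b m)"
proof -
  have "bump a b m = (\<lambda>x. flat 1 (real (Suc m) * x + - (real (Suc m) * a)) *
      flat 1 (- real (Suc m) * x + real (Suc m) * b))"
    by (auto simp: bump_def algebra_simps)
  then show ?thesis by (simp only: flat_algebra.intros)
qed

lemma bump_eq_0: "x \<notin> {a<..<b} \<Longrightarrow> bump a b m x = 0"
  by (auto simp: bump_def flat_def zero_less_mult_iff)

lemma bump_pos: "x \<in> {a<..<b} \<Longrightarrow> 0 < bump a b m x"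
  by (auto simp: bump_def flat_def)

lemma bump_nonneg: "0 \<le> bump a b m x"
  by (auto simp: bump_def flat_def)

lemma bump_le_1: "bump a b m x \<le> 1"
  unfolding bump_def by (intro mult_le_one) (auto simp: flat_def)

text \<open>At distance \<open>d\<close> inside an end point the factor is
  \<open>exp (- 1 / (d * Suc m))\<close>, which tends to 1; off the open interval all bumps
  vanish.\<close>

lemma bump_tendsto_indicator: "(\<lambda>m. bump a b m x) \<longlonglongrightarrow> indicator {a<..<b} x"
proof (cases "x \<in> {a<..<b}")
  case True
  have *: "(\<lambda>m. flat 1 (real (Suc m) * d)) \<longlonglongrightarrow> 1" if "d > 0" for d
  proof -
    have "(\<lambda>m. exp (- ((1 / d) * inverse (real (Suc m))))) \<longlonglongrightarrow> exp (- ((1 / d) * 0))"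
      by (intro tendsto_intros LIMSEQ_inverse_real_of_nat)
    moreover have "exp (- ((1 / d) * inverse (real (Suc m)))) = flat 1 (real (Suc m) * d)" for m
      using that by (simp add: flat_def zero_less_mult_iff inverse_eq_divide mult.commute)
    ultimately show ?thesis by simp
  qed
  have "(\<lambda>m. bump a b m x) \<longlonglongrightarrow> 1 * 1"
    unfolding bump_def using True by (intro tendsto_mult *) auto
  then show ?thesis using True by simp
qed (simp add: bump_eq_0)

lemma test_function_bump:
  assumes "-1 < a" "b < 1"
  shows "test_function (bump a b m)"
  using assms by (intro test_functionI[of _ a b] smooth_flat_algebra flat_algebra_bump bump_eq_0) auto

subsection \<open>The fundamental lemma of the calculus of variations\<close>

abbreviation M\<Omega> :: "real measure" where "M\<Omega> \<equiv> lebesgue_on Omega"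

section \<open>Integration over \<open>Omega\<close>: Bochner integrals and gauge integrals\<close>

lemma finite_measure_Omega: "finite_measure M\<Omega>"
  by (rule finite_measure_lebesgue_on) simp

lemma integrable_Omega_continuous:
  fixes f :: "real \<Rightarrow> 'a::euclidean_space"
  assumes "continuous_on {-1..1} f"
  shows "integrable M\<Omega> f"
proof -
  have "f absolutely_integrable_on {-1..1}"
    using absolutely_integrable_continuous[of "-1" 1 f] assms by simp
  then have "f absolutely_integrable_on Omega"
    using absolutely_integrable_on_open_interval[where f = f and a = "-1" and b = 1] by simp
  then show ?thesis by (rule absolutely_integrable_imp_integrable) simp
qed

lemma measurable_Omega_continuous:
  fixes f :: "real \<Rightarrow> 'a::euclidean_space"
  shows "continuous_on {-1..1} f \<Longrightarrow> f \<in> borel_measurable M\<Omega>"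
  using integrable_Omega_continuous borel_measurable_integrable by blast

lemma integrable_Omega_imp_integrable_on:
  fixes f :: "real \<Rightarrow> 'a::euclidean_space"
  assumes "integrable M\<Omega> f"
  shows "f integrable_on {-1..1}"
  using integrable_on_lebesgue_on[OF assms]
    integrable_on_open_interval[of f "-1" 1] by simp

lemma LINT_Omega_eq_integral:
  fixes f :: "real \<Rightarrow> 'a::euclidean_space"
  assumes "integrable M\<Omega> f"
  shows "(LINT x|M\<Omega>. f x) = integral {-1..1} f"
  using lebesgue_integral_eq_integral[OF assms] integral_open_interval[of "-1" 1 f] by simp

lemma measurable_Omega_indicator: "(\<lambda>x. indicator {a<..<b} x :: real) \<in> borel_measurable M\<Omega>"
  by (intro measurable_restrict_space1 measurable_completion) measurable

lemma integrable_Omega_scaleR: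
  fixes f :: "real \<Rightarrow> 'a::euclidean_space" and h :: "real \<Rightarrow> real"
  assumes f: "integrable M\<Omega> f" and h: "h \<in> borel_measurable M\<Omega>"
    and bound: "AE x in M\<Omega>. \<bar>h x\<bar> \<le> B"
  shows "integrable M\<Omega> (\<lambda>x. h x *\<^sub>R f x)"
proof (rule Bochner_Integration.integrable_bound)
  show "integrable M\<Omega> (\<lambda>x. B *\<^sub>R f x)" using f by simp
  show "(\<lambda>x. h x *\<^sub>R f x) \<in> borel_measurable M\<Omega>" using f h by measurable
  show "AE x in M\<Omega>. norm (h x *\<^sub>R f x) \<le> norm (B *\<^sub>R f x)"
    using bound by eventually_elim (auto intro!: mult_right_mono)
qed

lemma integrable_Omega_scaleR_continuous:
  fixes f :: "real \<Rightarrow> 'a::euclidean_space" and h :: "real \<Rightarrow> real"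
  assumes f: "integrable M\<Omega> f" and h: "continuous_on {-1..1} h"
  shows "integrable M\<Omega> (\<lambda>x. h x *\<^sub>R f x)"
proof -
  have "bounded (h ` {-1..1})"
    using compact_continuous_image[OF h] compact_imp_bounded by auto
  then obtain B where "\<forall>x\<in>{-1..1}. norm (h x) \<le> B"
    unfolding bounded_iff by blast
  then show ?thesis
    by (intro integrable_Omega_scaleR[OF f measurable_Omega_continuous[OF h], of B] AE_I2) auto
qed

lemma L2_integrable:
  assumes "u \<in> L2"
  shows "integrable M\<Omega> u"
proof (rule Bochner_Integration.integrable_bound)
  interpret finite_measure M\<Omega> by (rule finite_measure_Omega)
  show "integrable M\<Omega> (\<lambda>x. 1 + (cmod (u x))\<^sup>2)"
    using assms by (auto simp: L2_def)
  show "u \<in> borel_measurable M\<Omega>" using assms by (simp add: L2_def)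
  have "y \<le> 1 + y\<^sup>2" for y :: real
    using zero_le_power2[of "y - 1 / 2"] by (simp add: power2_eq_square algebra_simps)
  then show "AE x in M\<Omega>. norm (u x) \<le> norm (1 + (cmod (u x))\<^sup>2)"
    by (auto intro!: AE_I2)
qed

lemma L2_continuous:
  assumes "continuous_on {-1..1} u"
  shows "u \<in> L2"
  unfolding L2_def using assms
  by (auto intro!: measurable_Omega_continuous integrable_Omega_continuous continuous_intros)

lemma LINT_Omega_indicator:
  fixes f :: "real \<Rightarrow> 'a::euclidean_space"
  assumes f: "integrable M\<Omega> f" and ab: "-1 \<le> a" "b \<le> 1"
  shows "(LINT x|M\<Omega>. indicator {a<..<b} x *\<^sub>R f x) = integral {a..b} f"
proof -
  have "{a<..<b} \<inter> Omega = {a<..<b}" using ab by auto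
  then have sub: "{a<..<b} \<subseteq> Omega" by blast
  have "(LINT x|M\<Omega>. indicator {a<..<b} x *\<^sub>R f x) = integral\<^sup>L (lebesgue_on {a<..<b}) f"
    using Lebesgue_Measure.integral_restrict_Int[of "{a<..<b}" Omega f] \<open>{a<..<b} \<inter> Omega = {a<..<b}\<close>
    by (simp add: indicator_scaleR_eq_if)
  also have "\<dots> = integral {a<..<b} f"
    using set_integrable_subset[of lebesgue Omega f "{a<..<b}"] f sub
    by (intro lebesgue_integral_eq_integral)
      (auto simp: set_integrable_def integrable_restrict_space)
  finally show ?thesis
    using integral_open_interval[of a b f] by simp
qed

text \<open>Lebesgue differentiation turns vanishing interval integrals into vanishing almost everywhere.\<close>
lemma AE_zero_if_interval_integrals_zero:
  fixes f :: "real \<Rightarrow> complex"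
  assumes f: "integrable M\<Omega> f"
    and zero: "\<And>a b. -1 < a \<Longrightarrow> a < b \<Longrightarrow> b < 1 \<Longrightarrow> integral {a..b} f = 0"
  shows "AE x in M\<Omega>. f x = 0"
proof -
  \<comment> \<open>Extension by zero gives a function integrable on every box, as the
    differentiation theorem requires.\<close>
  define F where "F x = (if x \<in> Omega then f x else 0)" for x
  have "f integrable_on Omega"
    using integrable_on_lebesgue_on[OF f] by simp
  then have "F integrable_on UNIV"
    unfolding F_def using integrable_restrict_UNIV by blast
  then have "F integrable_on cbox a b" for a b
    using integrable_on_subcbox by blast
  then obtain N where N: "negligible N"
    and *: "\<And>x e. \<lbrakk>x \<notin> N; 0 < e\<rbrakk> \<Longrightarrow> \<exists>d>0. \<forall>h. 0 < h \<and> h < d \<longrightarrow>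
        norm (integral (cbox x (x + h *\<^sub>R One)) F /\<^sub>R h ^ DIM(real) - F x) < e"
    using integrable_ccontinuous_explicit[of F] by blast
  have "f x = 0" if x: "x \<in> Omega" "x \<notin> N" for x
  proof (rule ccontr)
    assume "f x \<noteq> 0"
    then obtain d where d: "d > 0" "\<And>h. 0 < h \<Longrightarrow> h < d \<Longrightarrow>
        norm (integral {x..x + h} F /\<^sub>R h - F x) < norm (f x)"
      using *[of x "norm (f x)"] x by auto
    \<comment> \<open>Halving keeps \<open>h\<close> below \<open>d\<close> and \<open>x + h\<close>
      inside \<open>Omega\<close>. The mean over the interval is then 0 and at distance less than
      \<open>norm (f x)\<close> from \<open>f x\<close>, which is absurd.\<close>
    define h where "h = min (d / 2) ((1 - x) / 2)"
    have h: "0 < h" "h < d" "x + h < 1"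
      using d(1) x by (auto simp: h_def min_def field_simps)
    have "integral {x..x + h} F = integral {x..x + h} f"
      by (intro integral_cong) (use x h in \<open>auto simp: F_def\<close>)
    then show False
      using d(2)[OF h(1,2)] zero[of x "x + h"] x h by (auto simp: F_def)
  qed
  then have "AE x in lebesgue. x \<in> Omega \<longrightarrow> f x = 0"
    using N by (intro AE_I'[of N]) (auto simp: negligible_iff_null_sets)
  then show ?thesis
    by (simp add: AE_restrict_space_iff)
qed

text \<open>Bumps lie between 0 and 1 and converge to indicators, so dominated convergence with
  majorant \<open>norm (f x)\<close> reduces the claim to interval integrals.\<close>

lemma AE_zero_if_bumps_zero:
  fixes f :: "real \<Rightarrow> complex"
  assumes f: "integrable M\<Omega> f"
    and zero: "\<And>a b m. -1 < a \<Longrightarrow> a < b \<Longrightarrow> b < 1 \<Longrightarrow> (LINT x|M\<Omega>. bump a b m x *\<^sub>R f x) = 0"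
  shows "AE x in M\<Omega>. f x = 0"
proof (rule AE_zero_if_interval_integrals_zero[OF f])
  fix a b :: real
  assume ab: "-1 < a" "a < b" "b < 1"
  have [measurable]: "f \<in> borel_measurable M\<Omega>" using f by simp
  have [measurable]: "bump a b m \<in> borel_measurable M\<Omega>" for m
    by (intro measurable_Omega_continuous flat_algebra_continuous_on flat_algebra_bump)
  have "(\<lambda>m. LINT x|M\<Omega>. bump a b m x *\<^sub>R f x) \<longlonglongrightarrow> (LINT x|M\<Omega>. indicator {a<..<b} x *\<^sub>R f x)"
  proof (rule integral_dominated_convergence)
    show "integrable M\<Omega> (\<lambda>x. norm (f x))" using f by simp
    show "AE x in M\<Omega>. (\<lambda>m. bump a b m x *\<^sub>R f x) \<longlonglongrightarrow> indicator {a<..<b} x *\<^sub>R f x"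
      by (intro AE_I2 tendsto_intros bump_tendsto_indicator)
    show "AE x in M\<Omega>. norm (bump a b m x *\<^sub>R f x) \<le> norm (f x)" for m
      using mult_right_mono[OF bump_le_1] bump_nonneg by (intro AE_I2) (fastforce simp: abs_of_nonneg)
  qed (use measurable_Omega_indicator in measurable)
  then have "(LINT x|M\<Omega>. indicator {a<..<b} x *\<^sub>R f x) = 0"
    using zero[OF ab] by (simp add: LIMSEQ_const_iff)
  then show "integral {a..b} f = 0"
    using LINT_Omega_indicator[OF f, of a b] ab by simp
qed

subsection \<open>Weak derivatives on an interval\<close>

text \<open>The antiderivative vanishes left of the support of \<open>h\<close>, and mean value zero
  makes it vanish to the right as well, so its support stays inside \<open>Omega\<close>.\<close>

lemma test_function_antiderivative:
  assumes h: "flat_algebra h" and zero: "\<And>x. x \<notin> {s<..<t} \<Longrightarrow> h x = 0"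
    and st: "-1 < s" "s < t" "t < 1" and int: "integral {-1..1} h = 0"
  defines "\<phi> \<equiv> \<lambda>x. integral {-1..x} h"
  shows "test_function \<phi>" and "deriv \<phi> = h"
proof -
  have cont: "continuous_on S h" for S by (rule flat_algebra_continuous_on[OF h])
  have int_h: "h integrable_on {a..b}" for a b by (rule integrable_continuous_real[OF cont])
  have int_0: "integral {a..b} h = 0" if "\<And>x. x \<in> {a..b} \<Longrightarrow> x \<notin> {s<..<t}" for a b
    using integral_cong[of "{a..b}" h "\<lambda>x. 0"] zero that by simp
  \<comment> \<open>This includes \<open>x < -1\<close>, where the interval is empty and the
    integral is 0.\<close>
  have left: "\<phi> x = 0" if "x \<le> s" for x
    unfolding \<phi>_def using that by (intro int_0) auto
  have right: "\<phi> x = 0" if "t \<le> x" for x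
  proof (cases "x \<le> 1")
    case True
    then have "\<phi> x + integral {x..1} h = 0"
      unfolding \<phi>_def using Henstock_Kurzweil_Integration.integral_combine[of "-1" x 1 h] int int_h that st by simp
    then show ?thesis using int_0[of x 1] that by simp
  next
    case False
    then have "integral {-1..1} h + integral {1..x} h = \<phi> x"
      unfolding \<phi>_def using Henstock_Kurzweil_Integration.integral_combine[of "-1" 1 x h] int_h by simp
    then show ?thesis using int_0[of 1 x] int st by simp
  qed
  \<comment> \<open>The fundamental theorem applies once \<open>x\<close> is interior to
    \<open>{-1..x + 1}\<close>, that is for \<open>x\<close> beyond -1; left of \<open>s\<close> the
    function is locally zero.\<close>
  have deriv: "(\<phi> has_real_derivative h x) (at x)" for x
  proof (cases "x < s")
    case True
    have "(\<phi> has_real_derivative 0) (at x)"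
      by (rule has_field_derivative_transform_within_open[of "\<lambda>x. 0" _ _ "{..<s}"])
        (use True left in auto)
    then show ?thesis using zero[of x] True by simp
  next
    case False
    have "(\<phi> has_real_derivative h x) (at x within {-1..x + 1})"
      unfolding \<phi>_def using False st by (intro integral_has_real_derivative cont) auto
    then show ?thesis
      using False st by (simp add: at_within_Icc_at)
  qed
  show "test_function \<phi>"
    using st left right
    by (intro test_functionI[of _ s t] smooth_antiderivative[OF h deriv]) auto
  show "deriv \<phi> = h"
    using deriv by (auto intro!: ext DERIV_imp_deriv)
qed

text \<open>Given a fixed bump \<open>\<psi>\<close>, subtracting a multiple of \<open>\<psi>\<close> makes every bump the derivative of a
  test function.\<close>
lemma du_Bois_Reymond:
  fixes f :: "real \<Rightarrow> complex"
  assumes f: "integrable M\<Omega> f"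
    and zero: "\<And>\<phi>. test_function \<phi> \<Longrightarrow> (LINT x|M\<Omega>. deriv \<phi> x *\<^sub>R f x) = 0"
  shows "\<exists>C. AE x in M\<Omega>. f x = C"
proof -
  interpret finite_measure M\<Omega> by (rule finite_measure_Omega)
  define \<psi> where "\<psi> = bump (- 1 / 2) (1 / 2) 0"
  define I where "I = integral {-1..1} \<psi>"
  \<comment> \<open>The weighted mean of \<open>f\<close> with weight \<open>\<psi>\<close>: if
    \<open>f\<close> is almost everywhere constant, this is its value.\<close>
  define C where "C = (LINT x|M\<Omega>. \<psi> x *\<^sub>R f x) /\<^sub>R I"
  note cont = flat_algebra_continuous_on[OF flat_algebra_bump]
  have "I \<noteq> 0"
  proof
    assume "I = 0"
    then have "\<forall>x\<in>{-1..1}. \<psi> x = 0"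
      unfolding I_def \<psi>_def
      by (subst integral_eq_0_iff[symmetric, OF cont _ bump_nonneg]) simp_all
    then have "\<psi> 0 = 0" by simp
    then show False using bump_pos[of 0 "- 1 / 2" "1 / 2" 0] by (simp add: \<psi>_def)
  qed
  have "AE x in M\<Omega>. f x - C = 0"
  proof (rule AE_zero_if_bumps_zero)
    show "integrable M\<Omega> (\<lambda>x. f x - C)" using f by simp
    fix a b :: real and m
    assume ab: "-1 < a" "a < b" "b < 1"
    define J where "J = integral {-1..1} (bump a b m)"
    \<comment> \<open>The multiple of \<open>\<psi>\<close> is chosen so that the integrals
      \<open>J\<close> and \<open>(J / I) * I\<close> cancel.\<close>
    define h where "h x = bump a b m x + (- (J / I)) * \<psi> x" for x
    have int: "integrable M\<Omega> (\<lambda>x. bump a b m x *\<^sub>R f x)" for a b m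
      by (rule integrable_Omega_scaleR_continuous[OF f cont])
    have J: "(LINT x|M\<Omega>. bump a b m x) = J"
      unfolding J_def by (intro LINT_Omega_eq_integral integrable_Omega_continuous cont)
    have h: "flat_algebra h"
      unfolding h_def \<psi>_def
      by (intro flat_algebra.add flat_algebra.mult flat_algebra.const flat_algebra_bump)
    have "integral {-1..1} h = J + integral {-1..1} (\<lambda>x. (- (J / I)) * \<psi> x)"
      unfolding h_def J_def \<psi>_def
      by (intro Henstock_Kurzweil_Integration.integral_add integrable_continuous_real continuous_intros cont)
    also have "\<dots> = J + (- (J / I)) * I"
      unfolding I_def by (simp only: Henstock_Kurzweil_Integration.integral_mult_right)
    finally have "integral {-1..1} h = J + (- (J / I)) * I" .
    then have "integral {-1..1} h = 0" using \<open>I \<noteq> 0\<close> by simp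
    \<comment> \<open>The interval is the hull of both supports and still has its ends inside
      \<open>Omega\<close>.\<close>
    moreover have "h x = 0" if "x \<notin> {min a (- 1 / 2)<..<max b (1 / 2)}" for x
    proof -
      have "x \<notin> {a<..<b}" "x \<notin> {- 1 / 2<..<1 / 2}" using that by auto
      then show ?thesis by (simp add: h_def \<psi>_def bump_eq_0 del: greaterThanLessThan_iff)
    qed
    ultimately have "test_function (\<lambda>x. integral {-1..x} h)" "deriv (\<lambda>x. integral {-1..x} h) = h"
      using ab by (intro test_function_antiderivative[OF h, of "min a (- 1 / 2)" "max b (1 / 2)"]; simp)+
    then have h0: "(LINT x|M\<Omega>. h x *\<^sub>R f x) = 0"
      using zero by metis
    have "(\<lambda>x. h x *\<^sub>R f x) = (\<lambda>x. bump a b m x *\<^sub>R f x - (J / I) *\<^sub>R (\<psi> x *\<^sub>R f x))"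
      by (simp add: h_def fun_eq_iff scaleR_diff_left)
    moreover have "(LINT x|M\<Omega>. bump a b m x *\<^sub>R f x - (J / I) *\<^sub>R (\<psi> x *\<^sub>R f x)) =
        (LINT x|M\<Omega>. bump a b m x *\<^sub>R f x) - (J / I) *\<^sub>R (LINT x|M\<Omega>. \<psi> x *\<^sub>R f x)"
      unfolding \<psi>_def
      by (subst Bochner_Integration.integral_diff)
        (auto intro!: int integrable_scaleR_right simp del: scaleR_scaleR)
    ultimately have "(LINT x|M\<Omega>. bump a b m x *\<^sub>R f x) = (J / I) *\<^sub>R (LINT x|M\<Omega>. \<psi> x *\<^sub>R f x)"
      using h0 by simp
    moreover have "(LINT x|M\<Omega>. bump a b m x *\<^sub>R C) = J *\<^sub>R C"
      using J integrable_Omega_continuous[OF cont, of a b m] by simp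
    ultimately show "(LINT x|M\<Omega>. bump a b m x *\<^sub>R (f x - C)) = 0"
      using int[of a b m] integrable_Omega_continuous[OF cont, of a b m]
      by (auto simp: scaleR_diff_right C_def divide_inverse)
  qed
  then show ?thesis by (intro exI[of _ C]) simp
qed

text \<open>Integration by parts for a merely integrable \<open>g\<close>: Fubini on the triangle
  \<open>t < x\<close> turns the left side into the integral of \<open>g t\<close> times
  \<open>\<phi> 1 - \<phi> t\<close>.\<close>

lemma LINT_derivative_indefinite_integral:
  fixes g :: "real \<Rightarrow> complex" and \<phi> :: "real \<Rightarrow> real"
  assumes g: "integrable M\<Omega> g"
    and \<phi>: "\<And>x. (\<phi> has_real_derivative \<phi>' x) (at x)" and cont: "continuous_on {-1..1} \<phi>'"
    and \<phi>1: "\<phi> 1 = 0"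
  shows "(LINT x|M\<Omega>. \<phi>' x *\<^sub>R integral {-1..x} g) = - (LINT x|M\<Omega>. \<phi> x *\<^sub>R g x)"
proof -
  interpret finite_measure M\<Omega> by (rule finite_measure_Omega)
  interpret P: pair_sigma_finite M\<Omega> M\<Omega> ..
  define h where "h x t = (\<phi>' x * indicator {p. snd p < fst p} (x, t)) *\<^sub>R g t" for x t
  have [measurable]: "g \<in> borel_measurable M\<Omega>" using g by simp
  have [measurable]: "\<phi>' \<in> borel_measurable M\<Omega>" by (rule measurable_Omega_continuous[OF cont])
  have [measurable]: "(\<lambda>x. x) \<in> borel_measurable M\<Omega>"
    by (intro measurable_Omega_continuous continuous_intros)
  have [measurable]: "fst \<in> borel_measurable (M\<Omega> \<Otimes>\<^sub>M M\<Omega>)" "snd \<in> borel_measurable (M\<Omega> \<Otimes>\<^sub>M M\<Omega>)"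
    by (rule measurable_compose[OF measurable_fst, of "\<lambda>x. x", simplified]; measurable)
       (rule measurable_compose[OF measurable_snd, of "\<lambda>x. x", simplified]; measurable)
  have [measurable]: "(\<lambda>p. indicator {p. snd p < fst p} p :: real) \<in> borel_measurable (M\<Omega> \<Otimes>\<^sub>M M\<Omega>)"
    unfolding indicator_def by measurable
  have "bounded (\<phi>' ` {-1..1})"
    using compact_continuous_image[OF cont] compact_imp_bounded by auto
  then obtain B where B: "\<forall>x\<in>{-1..1}. norm (\<phi>' x) \<le> B"
    unfolding bounded_iff by blast
  have "integrable (M\<Omega> \<Otimes>\<^sub>M M\<Omega>) (case_prod h)"
  proof (rule Bochner_Integration.integrable_bound)
    \<comment> \<open>The majorant does not depend on \<open>x\<close>; it is integrable on the
      product because \<open>Omega\<close> has finite measure.\<close>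
    show "integrable (M\<Omega> \<Otimes>\<^sub>M M\<Omega>) (\<lambda>(x, t). B *\<^sub>R g t)"
      using g by (intro P.Fubini_integrable) auto
    show "case_prod h \<in> borel_measurable (M\<Omega> \<Otimes>\<^sub>M M\<Omega>)"
      unfolding h_def by measurable
    show "AE p in M\<Omega> \<Otimes>\<^sub>M M\<Omega>. norm (case_prod h p) \<le> norm (case p of (x, t) \<Rightarrow> B *\<^sub>R g t)"
    proof (intro AE_I2)
      fix p assume "p \<in> space (M\<Omega> \<Otimes>\<^sub>M M\<Omega>)"
      then have "fst p \<in> {-1..1}" by (auto simp: space_pair_measure)
      then have "norm (\<phi>' (fst p)) \<le> B" using B by blast
      then have "\<bar>\<phi>' (fst p)\<bar> \<le> \<bar>B\<bar>" by simp
      then show "norm (case_prod h p) \<le> norm (case p of (x, t) \<Rightarrow> B *\<^sub>R g t)"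
        by (auto simp: h_def indicator_def split: prod.split intro!: mult_right_mono)
    qed
  qed
  then have "(LINT t|M\<Omega>. LINT x|M\<Omega>. h x t) = (LINT x|M\<Omega>. LINT t|M\<Omega>. h x t)"
    by (rule P.Fubini_integral)
  moreover have "(LINT x|M\<Omega>. h x t) = - (\<phi> t *\<^sub>R g t)" if t: "t \<in> Omega" for t
  proof -
    have "(LINT x|M\<Omega>. h x t) = (LINT x|M\<Omega>. (indicator {t<..<1} x *\<^sub>R \<phi>' x) *\<^sub>R g t)"
      by (intro Bochner_Integration.integral_cong) (auto simp: h_def indicator_def)
    also have "\<dots> = (LINT x|M\<Omega>. indicator {t<..<1} x *\<^sub>R \<phi>' x) *\<^sub>R g t"
    proof (cases "g t = 0")
      case False
      have "integrable M\<Omega> (\<lambda>x. indicator {t<..<1} x *\<^sub>R \<phi>' x)"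
        by (rule integrable_Omega_scaleR[of _ _ 1])
          (auto intro!: integrable_Omega_continuous cont measurable_Omega_indicator simp: indicator_def)
      then show ?thesis by (intro integral_scaleR_left)
    qed simp
    also have "\<dots> = integral {t..1} \<phi>' *\<^sub>R g t"
      using t by (subst LINT_Omega_indicator) (auto intro!: integrable_Omega_continuous cont)
    also have "integral {t..1} \<phi>' = \<phi> 1 - \<phi> t"
      using t \<phi> by (intro integral_unique fundamental_theorem_of_calculus)
        (auto simp: has_real_derivative_iff_has_vector_derivative[symmetric]
          intro: has_field_derivative_at_within)
    finally show ?thesis by (simp add: \<phi>1)
  qed
  moreover have "(LINT t|M\<Omega>. h x t) = \<phi>' x *\<^sub>R integral {-1..x} g" if x: "x \<in> Omega" for x
  proof -
    have "(LINT t|M\<Omega>. h x t) = (LINT t|M\<Omega>. \<phi>' x *\<^sub>R (indicator {-1<..<x} t *\<^sub>R g t))"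
      by (intro Bochner_Integration.integral_cong) (auto simp: h_def indicator_def)
    also have "\<dots> = \<phi>' x *\<^sub>R (LINT t|M\<Omega>. indicator {-1<..<x} t *\<^sub>R g t)"
      by (rule integral_scaleR_right)
    also have "\<dots> = \<phi>' x *\<^sub>R integral {-1..x} g"
      using x by (subst LINT_Omega_indicator[OF g]) auto
    finally show ?thesis .
  qed
  ultimately show ?thesis
    using Bochner_Integration.integral_cong[of M\<Omega> M\<Omega> "\<lambda>t. LINT x|M\<Omega>. h x t" "\<lambda>t. - (\<phi> t *\<^sub>R g t)"]
      Bochner_Integration.integral_cong[of M\<Omega> M\<Omega> "\<lambda>x. LINT t|M\<Omega>. h x t" "\<lambda>x. \<phi>' x *\<^sub>R integral {-1..x} g"]
    by simp
qed

lemma test_function_deriv: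
  assumes "test_function \<phi>"
  shows "(\<phi> has_real_derivative deriv \<phi> x) (at x)"
proof -
  have "(deriv ^^ 0) \<phi> differentiable (at x)"
    using assms unfolding test_function_def smooth_def by blast
  then show ?thesis by (simp add: DERIV_deriv_iff_real_differentiable)
qed

lemma test_function_deriv_continuous:
  assumes "test_function \<phi>"
  shows "continuous_on S (deriv \<phi>)"
proof -
  have "(deriv ^^ 1) \<phi> differentiable (at x)" for x
    using assms unfolding test_function_def smooth_def by blast
  then show ?thesis
    by (intro continuous_at_imp_continuous_on) (auto simp: differentiable_imp_continuous_within)
qed

lemma test_function_eq_0: "test_function \<phi> \<Longrightarrow> x \<notin> Omega \<Longrightarrow> \<phi> x = 0"
  using closure_subset[of "{x. \<phi> x \<noteq> 0}"] unfolding test_function_def by auto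

text \<open>The one-dimensional Sobolev embedding: \<open>u\<close> minus the indefinite integral of
  \<open>g\<close> is annihilated by derivatives of test functions, hence almost everywhere
  constant.\<close>

lemma has_weak_deriv_representative:
  assumes "has_weak_deriv u g"
  shows "\<exists>C. AE x in M\<Omega>. u x = C + integral {-1..x} g"
proof -
  have u: "integrable M\<Omega> u" and g: "integrable M\<Omega> g"
    using assms by (auto simp: has_weak_deriv_def intro: L2_integrable)
  have contG: "continuous_on {-1..1} (\<lambda>x. integral {-1..x} g)"
    by (intro indefinite_integral_continuous_1 integrable_Omega_imp_integrable_on g)
  have intG: "integrable M\<Omega> (\<lambda>x. integral {-1..x} g)"
    by (rule integrable_Omega_continuous[OF contG])
  have "\<exists>C. AE x in M\<Omega>. u x - integral {-1..x} g = C"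
  proof (rule du_Bois_Reymond)
    show "integrable M\<Omega> (\<lambda>x. u x - integral {-1..x} g)" using u intG by simp
    fix \<phi> assume \<phi>: "test_function \<phi>"
    note cont = test_function_deriv_continuous[OF \<phi>]
    have "(LINT x|M\<Omega>. deriv \<phi> x *\<^sub>R (u x - integral {-1..x} g)) =
        (LINT x|M\<Omega>. deriv \<phi> x *\<^sub>R u x) - (LINT x|M\<Omega>. deriv \<phi> x *\<^sub>R integral {-1..x} g)"
      unfolding scaleR_diff_right
      by (intro Bochner_Integration.integral_diff integrable_Omega_scaleR_continuous u intG cont)
    also have "\<dots> = 0"
      using assms \<phi> LINT_derivative_indefinite_integral[OF g test_function_deriv[OF \<phi>] cont]
      by (simp add: has_weak_deriv_def test_function_eq_0)
    finally show "(LINT x|M\<Omega>. deriv \<phi> x *\<^sub>R (u x - integral {-1..x} g)) = 0" .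
  qed
  then show ?thesis by (auto simp: diff_eq_eq)
qed

text \<open>Bumps are test functions, so the defining identity gives both candidates the same
  integrals against every bump.\<close>

lemma has_weak_deriv_unique:
  assumes "has_weak_deriv u g" "has_weak_deriv u g'"
  shows "AE x in M\<Omega>. g x = g' x"
proof -
  have g: "integrable M\<Omega> g" "integrable M\<Omega> g'"
    using assms by (auto simp: has_weak_deriv_def intro: L2_integrable)
  have "AE x in M\<Omega>. g x - g' x = 0"
  proof (rule AE_zero_if_bumps_zero)
    show "integrable M\<Omega> (\<lambda>x. g x - g' x)" using g by simp
    fix a b :: real and m assume "-1 < a" "a < b" "b < 1"
    then have test: "test_function (bump a b m)" by (intro test_function_bump)
    have "(LINT x|M\<Omega>. bump a b m x *\<^sub>R k x) = - (LINT x|M\<Omega>. deriv (bump a b m) x *\<^sub>R u x)"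
      if "has_weak_deriv u k" for k
      using that test by (simp add: has_weak_deriv_def)
    then have "(LINT x|M\<Omega>. bump a b m x *\<^sub>R g x) = (LINT x|M\<Omega>. bump a b m x *\<^sub>R g' x)"
      using assms by simp
    then show "(LINT x|M\<Omega>. bump a b m x *\<^sub>R (g x - g' x)) = 0"
      unfolding scaleR_diff_right
      by (subst Bochner_Integration.integral_diff)
        (auto intro!: integrable_Omega_scaleR_continuous g flat_algebra_continuous_on flat_algebra_bump)
  qed
  then show ?thesis by simp
qed

section \<open>Continuous representatives, traces and smooth elements of \<open>H1\<close>\<close>

lemma AE_eq_continuous_imp_eq:
  fixes v w :: "real \<Rightarrow> complex"
  assumes "continuous_on {-1..1} v" "continuous_on {-1..1} w" "AE x in M\<Omega>. v x = w x"
    and "x \<in> {-1..1}"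
  shows "v x = w x"
proof -
  let ?d = "\<lambda>x. norm (v x - w x)"
  have cont: "continuous_on {-1..1} ?d" using assms by (intro continuous_intros)
  have "(LINT x|M\<Omega>. ?d x) = 0" using assms(3) by (intro integral_eq_zero_AE) auto
  \<comment> \<open>Moving to the closed interval brings in the end points, which the measure on
    \<open>Omega\<close> does not see.\<close>
  then have "integral {-1..1} ?d = 0"
    using LINT_Omega_eq_integral[OF integrable_Omega_continuous[OF cont]] by simp
  then show ?thesis using integral_eq_0_iff[OF cont] assms(4) by auto
qed

text \<open>This removes the choice operator: all continuous representatives agree up to the
  boundary, so any one of them computes the trace.\<close>

lemma trace_eq:
  assumes "continuous_on {-1..1} w" "AE x in M\<Omega>. w x = u x" "x \<in> {-1..1}"
  shows "trace u x = w x"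
proof -
  have *: "continuous_on {-1..1} (trace u) \<and> (AE x in M\<Omega>. trace u x = u x)"
    unfolding trace_def by (rule someI[of _ w]) (use assms in auto)
  then have "AE x in M\<Omega>. trace u x = w x"
    using assms(2) by (auto elim!: eventually_elim2)
  then show ?thesis
    using AE_eq_continuous_imp_eq[OF conjunct1[OF *] assms(1) _ assms(3)] by blast
qed

text \<open>Supplies explicit elements of \<open>H1\<close> for the weak formulation. The product
  rule gives the identity, because test functions vanish at both ends.\<close>

lemma has_weak_deriv_C1:
  assumes v: "\<And>x. (v has_vector_derivative v' x) (at x)" and v': "continuous_on UNIV v'"
  shows "has_weak_deriv v v'"
  unfolding has_weak_deriv_def
proof (intro conjI allI impI)
  have cv: "continuous_on S v" for S
    by (intro continuous_at_imp_continuous_on ballI has_vector_derivative_continuous[OF v])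
  have cv': "continuous_on S v'" for S
    using v' continuous_on_subset by blast
  show "v \<in> L2" "v' \<in> L2" by (intro L2_continuous cv cv')+
  fix \<phi> assume \<phi>: "test_function \<phi>"
  note d\<phi> = test_function_deriv[OF \<phi>] and c\<phi>' = test_function_deriv_continuous[OF \<phi>]
  have c\<phi>: "continuous_on S \<phi>" for S
    by (intro continuous_at_imp_continuous_on ballI DERIV_isCont[OF d\<phi>])
  have "((\<lambda>x. \<phi> x *\<^sub>R v' x + deriv \<phi> x *\<^sub>R v x) has_integral \<phi> 1 *\<^sub>R v 1 - \<phi> (-1) *\<^sub>R v (-1)) {-1..1}"
    by (rule fundamental_theorem_of_calculus)
      (simp_all add: has_vector_derivative_at_within[OF has_vector_derivative_scaleR[OF d\<phi> v]])
  then have "integral {-1..1} (\<lambda>x. \<phi> x *\<^sub>R v' x + deriv \<phi> x *\<^sub>R v x) = 0"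
    using \<phi> by (simp add: test_function_eq_0 integral_unique)
  moreover have "integrable M\<Omega> (\<lambda>x. \<phi> x *\<^sub>R v' x)" "integrable M\<Omega> (\<lambda>x. deriv \<phi> x *\<^sub>R v x)"
    by (intro integrable_Omega_continuous continuous_intros cv cv' c\<phi> c\<phi>')+
  ultimately show "(LINT x|M\<Omega>. deriv \<phi> x *\<^sub>R v x) = - (LINT x|M\<Omega>. \<phi> x *\<^sub>R v' x)"
    using LINT_Omega_eq_integral[of "\<lambda>x. \<phi> x *\<^sub>R v' x + deriv \<phi> x *\<^sub>R v x"]
    by (simp add: eq_neg_iff_add_eq_0 add.commute)
qed

lemma has_weak_deriv_weak_deriv: "has_weak_deriv u g \<Longrightarrow> has_weak_deriv u (weak_deriv u)"
  unfolding weak_deriv_def by (rule someI[of "has_weak_deriv u"])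

lemma weak_deriv_AE_eq: "has_weak_deriv u g \<Longrightarrow> AE x in M\<Omega>. weak_deriv u x = g x"
  by (rule has_weak_deriv_unique[OF has_weak_deriv_weak_deriv])

subsection \<open>Regularity of weak solutions\<close>

lemma integral_Omega_cong_AE:
  fixes f h :: "real \<Rightarrow> complex"
  assumes "integrable M\<Omega> f" "integrable M\<Omega> h" "AE x in M\<Omega>. f x = h x" "x \<le> 1"
  shows "integral {-1..x} f = integral {-1..x} h"
proof -
  have "(LINT t|M\<Omega>. indicator {-1<..<x} t *\<^sub>R f t) = (LINT t|M\<Omega>. indicator {-1<..<x} t *\<^sub>R h t)"
    using assms by (intro integral_cong_AE) (auto intro!: borel_measurable_scaleR measurable_Omega_indicator)
  then show ?thesis
    using LINT_Omega_indicator[of f "-1" x] LINT_Omega_indicator[of h "-1" x] assms by simp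
qed

lemma indefinite_integral_has_vector_derivative:
  fixes f :: "real \<Rightarrow> complex"
  assumes "f integrable_on {-1..1}" "t \<in> Omega" "isCont f t"
  shows "((\<lambda>x. integral {-1..x} f) has_vector_derivative f t) (at t)"
proof -
  have "((\<lambda>x. integral {-1..x} f) has_vector_derivative f t) (at t within ({-1..1} - {}))"
    using assms by (intro integral_has_vector_derivative_continuous_at)
      (auto intro: continuous_at_imp_continuous_at_within)
  then show ?thesis
    using assms(2) by (simp add: at_within_Icc_at)
qed

lemma AE_Omega_not_in_finite: "finite S \<Longrightarrow> AE x in M\<Omega>. x \<notin> S"
  by (auto simp: AE_restrict_space_iff negligible_finite simp flip: negligible_iff_null_sets
      intro!: AE_I'[of S])

text \<open>Here \<open>w\<close> and \<open>p\<close> are the continuous representatives of \<open>u\<close> and its weak derivative;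
  the last two conclusions come from testing with \<open>1 - x\<close> and with \<open>u\<close> itself.\<close>
lemma weak_solution_classical:
  assumes sol: "weak_solution \<omega> c g1 g2 u"
    and S: "finite S" and contK: "\<And>t. t \<in> Omega - S \<Longrightarrow> isCont (\<lambda>x. (\<omega> / c x)\<^sup>2) t"
    and boundK: "\<And>t. t \<in> Omega - S \<Longrightarrow> (\<omega> / c t)\<^sup>2 \<le> B"
  obtains w p where
    "continuous_on {-1..1} w" "continuous_on {-1..1} p"
    "AE x in M\<Omega>. u x = w x" "AE x in M\<Omega>. weak_deriv u x = p x"
    "\<And>t. t \<in> Omega \<Longrightarrow> (w has_vector_derivative p t) (at t)"
    "\<And>t. t \<in> Omega - S \<Longrightarrow> (p has_vector_derivative - ((\<omega> / c t)\<^sup>2 *\<^sub>R w t)) (at t)"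
    "- p (-1) - \<i> * of_real (\<omega> / c (-1)) * w (-1) = g1"
    "\<omega> / c (-1) * (cmod (w (-1)))\<^sup>2 + \<omega> / c 1 * (cmod (w 1))\<^sup>2 =
       - Im (g1 * cnj (w (-1)) + g2 * cnj (w 1))"
proof -
  define K where "K x = (\<omega> / c x)\<^sup>2" for x
  define g where "g = weak_deriv u"
  have u: "has_weak_deriv u g"
    using sol unfolding weak_solution_def H1_def g_def by (auto intro: has_weak_deriv_weak_deriv)
  then have L2: "u \<in> L2" "g \<in> L2" by (auto simp: has_weak_deriv_def)
  then have iu: "integrable M\<Omega> u" and ig: "integrable M\<Omega> g" by (auto intro: L2_integrable)
  have weak: "(LINT x|M\<Omega>. g x * cnj (weak_deriv v x) - of_real (K x) * u x * cnj (v x))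
        - \<i> * (of_real (\<omega> / c (-1)) * trace u (-1) * cnj (trace v (-1)) +
                 of_real (\<omega> / c 1) * trace u 1 * cnj (trace v 1))
        = g1 * cnj (trace v (-1)) + g2 * cnj (trace v 1)" if "has_weak_deriv v v'" for v v'
    using sol that unfolding weak_solution_def H1_def g_def K_def by auto
  \<comment> \<open>Nothing is known about \<open>c\<close> on \<open>S\<close>, but measurability
    may be checked off a countable set, and there \<open>K\<close> is continuous.\<close>
  have K[measurable]: "K \<in> borel_measurable M\<Omega>"
  proof (rule measurable_restrict_countable[of "S \<inter> Omega"])
    have "continuous_on (Omega - S) K"
      using contK unfolding K_def by (auto intro: continuous_at_imp_continuous_on)
    moreover have "Omega - S \<in> sets lebesgue"
      using negligible_imp_sets[OF negligible_finite[OF S]] by (intro sets.Diff) auto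
    moreover have "restrict_space M\<Omega> (- (S \<inter> Omega)) = lebesgue_on (Omega - S)"
    proof -
      have "S \<inter> Omega \<in> sets lebesgue"
        using S by (intro negligible_imp_sets negligible_finite) simp
      then have "- (S \<inter> Omega) \<in> sets lebesgue"
        by (simp only: Compl_in_sets_lebesgue)
      moreover have "Omega \<inter> - (S \<inter> Omega) = Omega - S" by blast
      ultimately show ?thesis by (simp add: restrict_restrict_space)
    qed
    ultimately show "K \<in> borel_measurable (restrict_space M\<Omega> (- (S \<inter> Omega)))"
      using continuous_imp_measurable_on_sets_lebesgue by simp
  qed (use S in \<open>auto intro: countable_finite simp: sets_restrict_space\<close>)
  have aeS: "AE x in M\<Omega>. x \<in> Omega - S"
    using AE_Omega_not_in_finite[OF S] AE_space by eventually_elim auto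
  have Kbound: "AE x in M\<Omega>. \<bar>K x\<bar> \<le> B"
    using aeS by eventually_elim (use boundK in \<open>auto simp: K_def\<close>)
  have iKu: "integrable M\<Omega> (\<lambda>x. K x *\<^sub>R f x)" if "integrable M\<Omega> f" for f :: "real \<Rightarrow> complex"
    by (rule integrable_Omega_scaleR[OF that K Kbound])

  \<comment> \<open>For real continuously differentiable test functions the conjugates disappear,
    traces become point values and the chosen weak derivative becomes the classical one.\<close>
  have weak_C1: "(LINT x|M\<Omega>. \<phi>' x *\<^sub>R g x - \<phi> x *\<^sub>R (K x *\<^sub>R u x))
      - \<i> * (of_real (\<omega> / c (-1)) * trace u (-1) * \<phi> (-1) + of_real (\<omega> / c 1) * trace u 1 * \<phi> 1)
      = g1 * \<phi> (-1) + g2 * \<phi> 1"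
    if d: "\<And>x. (\<phi> has_real_derivative \<phi>' x) (at x)" and cont: "continuous_on UNIV \<phi>'" for \<phi> \<phi>'
  proof -
    define v where "v x = complex_of_real (\<phi> x)" for x
    define v' where "v' x = complex_of_real (\<phi>' x)" for x
    have v: "has_weak_deriv v v'"
      using d cont unfolding v_def v'_def
      by (intro has_weak_deriv_C1 has_vector_derivative_of_real continuous_intros)
        (simp_all add: has_real_derivative_iff_has_vector_derivative)
    have c\<phi>: "continuous_on X \<phi>" for X
      by (intro continuous_at_imp_continuous_on ballI DERIV_isCont[OF d])
    have c\<phi>': "continuous_on X \<phi>'" for X
      using cont continuous_on_subset by blast
    have tr: "trace v x = \<phi> x" if "x \<in> {-1..1}" for x
      using trace_eq[of v v x] that c\<phi> by (simp add: v_def continuous_on_of_real)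
    have [measurable]: "weak_deriv v \<in> borel_measurable M\<Omega>" "v \<in> borel_measurable M\<Omega>"
      using has_weak_deriv_weak_deriv[OF v] by (auto simp: has_weak_deriv_def L2_def)
    have [measurable]: "\<phi> \<in> borel_measurable M\<Omega>" "\<phi>' \<in> borel_measurable M\<Omega>"
      by (intro measurable_Omega_continuous c\<phi> c\<phi>')+
    have [measurable]: "u \<in> borel_measurable M\<Omega>" "g \<in> borel_measurable M\<Omega>"
      using iu ig by auto
    have "(LINT x|M\<Omega>. g x * cnj (weak_deriv v x) - of_real (K x) * u x * cnj (v x)) =
        (LINT x|M\<Omega>. \<phi>' x *\<^sub>R g x - \<phi> x *\<^sub>R (K x *\<^sub>R u x))"
    proof (rule integral_cong_AE)
      have "(\<lambda>x. cnj (weak_deriv v x)) \<in> borel_measurable M\<Omega>" "(\<lambda>x. cnj (v x)) \<in> borel_measurable M\<Omega>"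
        by (auto intro!: borel_measurable_continuous_on[where f = cnj] continuous_intros)
      then show "(\<lambda>x. g x * cnj (weak_deriv v x) - of_real (K x) * u x * cnj (v x)) \<in> borel_measurable M\<Omega>"
        by measurable
      show "AE x in M\<Omega>. g x * cnj (weak_deriv v x) - of_real (K x) * u x * cnj (v x) =
          \<phi>' x *\<^sub>R g x - \<phi> x *\<^sub>R (K x *\<^sub>R u x)"
        using weak_deriv_AE_eq[OF v]
        by eventually_elim (simp add: v_def v'_def scaleR_conv_of_real mult_ac)
    qed measurable
    then show ?thesis
      using weak[OF v] by (simp add: tr)
  qed

  \<comment> \<open>With compactly supported test functions the boundary terms drop out, and the
    weak form says that \<open>g\<close> itself has a weak derivative.\<close>
  have g_weak: "has_weak_deriv g (\<lambda>x. - (K x *\<^sub>R u x))"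
    unfolding has_weak_deriv_def
  proof (intro conjI allI impI)
    show "g \<in> L2" by fact
    have "AE x in M\<Omega>. \<bar>(K x)\<^sup>2\<bar> \<le> B\<^sup>2"
      using Kbound by eventually_elim (use power_mono[of "\<bar>K x\<bar>" B 2 for x] in simp)
    then have "integrable M\<Omega> (\<lambda>x. (K x)\<^sup>2 *\<^sub>R (cmod (u x))\<^sup>2)"
      using L2(1) by (intro integrable_Omega_scaleR) (auto simp: L2_def)
    then show "(\<lambda>x. - (K x *\<^sub>R u x)) \<in> L2"
      using iu unfolding L2_def by (auto simp: power_mult_distrib)
    fix \<phi> assume \<phi>: "test_function \<phi>"
    note d = test_function_deriv[OF \<phi>] and cont = test_function_deriv_continuous[OF \<phi>]
    have c\<phi>: "continuous_on X \<phi>" for X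
      by (intro continuous_at_imp_continuous_on ballI DERIV_isCont[OF d])
    have "(LINT x|M\<Omega>. deriv \<phi> x *\<^sub>R g x - \<phi> x *\<^sub>R (K x *\<^sub>R u x)) = 0"
      using weak_C1[OF d cont] \<phi> by (simp add: test_function_eq_0)
    moreover have "integrable M\<Omega> (\<lambda>x. deriv \<phi> x *\<^sub>R g x)" "integrable M\<Omega> (\<lambda>x. \<phi> x *\<^sub>R (K x *\<^sub>R u x))"
      by (intro integrable_Omega_scaleR_continuous ig iKu iu cont c\<phi>)+
    ultimately show "(LINT x|M\<Omega>. deriv \<phi> x *\<^sub>R g x) = - (LINT x|M\<Omega>. \<phi> x *\<^sub>R - (K x *\<^sub>R u x))"
      by simp
  qed

  obtain C where C: "AE x in M\<Omega>. u x = C + integral {-1..x} g"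
    using has_weak_deriv_representative[OF u] by blast
  obtain D where D: "AE x in M\<Omega>. g x = D + integral {-1..x} (\<lambda>x. - (K x *\<^sub>R u x))"
    using has_weak_deriv_representative[OF g_weak] by blast
  define w where "w x = C + integral {-1..x} g" for x
  define p where "p x = D + integral {-1..x} (\<lambda>x. - (K x *\<^sub>R u x))" for x
  have iKu': "integrable M\<Omega> (\<lambda>x. - (K x *\<^sub>R u x))" using iKu[OF iu] by simp
  have w: "continuous_on {-1..1} w"
    unfolding w_def
    by (intro continuous_intros indefinite_integral_continuous_1 integrable_Omega_imp_integrable_on ig)
  have p: "continuous_on {-1..1} p"
    unfolding p_def
    by (intro continuous_intros indefinite_integral_continuous_1 integrable_Omega_imp_integrable_on iKu')
  have uw: "AE x in M\<Omega>. u x = w x" and gp: "AE x in M\<Omega>. g x = p x"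
    using C D by (simp_all add: w_def p_def)
  have iw: "integrable M\<Omega> w" and ip: "integrable M\<Omega> p"
    by (intro integrable_Omega_continuous w p)+
  have iKw: "integrable M\<Omega> (\<lambda>x. - (K x *\<^sub>R w x))" using iKu[OF iw] by simp
  have isCont: "isCont w t" "isCont p t" if "t \<in> Omega" for t
    using w p that by (auto intro: continuous_on_interior)
  \<comment> \<open>Replacing \<open>g\<close> by its continuous representative \<open>p\<close>
    leaves the indefinite integral unchanged, so \<open>w\<close> is differentiable at every point
    and not just almost everywhere.\<close>
  have dw: "(w has_vector_derivative p t) (at t)" if t: "t \<in> Omega" for t
  proof -
    have "((\<lambda>x. C + integral {-1..x} p) has_vector_derivative p t) (at t)"
      using indefinite_integral_has_vector_derivative[OF integrable_Omega_imp_integrable_on[OF ip] t isCont(2)[OF t]]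
      by (auto intro!: derivative_eq_intros)
    then show ?thesis
      by (rule has_vector_derivative_transform_within_open[of _ _ _ Omega])
        (use t integral_Omega_cong_AE[OF ig ip gp] in \<open>auto simp: w_def\<close>)
  qed
  have dp: "(p has_vector_derivative - (K t *\<^sub>R w t)) (at t)" if t: "t \<in> Omega - S" for t
  proof -
    have "isCont (\<lambda>x. - (K x *\<^sub>R w x)) t"
      using isCont(1)[of t] contK[of t, folded K_def] t by (intro continuous_intros) auto
    then have "((\<lambda>x. integral {-1..x} (\<lambda>x. - (K x *\<^sub>R w x))) has_vector_derivative - (K t *\<^sub>R w t)) (at t)"
      using indefinite_integral_has_vector_derivative[OF integrable_Omega_imp_integrable_on[OF iKw], of t] t
      by blast
    then have "((\<lambda>x. D + integral {-1..x} (\<lambda>x. - (K x *\<^sub>R w x))) has_vector_derivative - (K t *\<^sub>R w t)) (at t)"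
      using has_vector_derivative_add[OF has_vector_derivative_const] by (metis add_0)
    moreover have "AE x in M\<Omega>. - (K x *\<^sub>R u x) = - (K x *\<^sub>R w x)"
      using uw by eventually_elim simp
    ultimately show ?thesis
      by (elim has_vector_derivative_transform_within_open[of _ _ _ Omega])
        (use t integral_Omega_cong_AE[OF iKu' iKw] in \<open>auto simp: p_def\<close>)
  qed
  have tr: "trace u x = w x" if "x \<in> {-1..1}" for x
    using trace_eq[OF w _ that, of u] uw by (simp add: eq_commute)

  \<comment> \<open>The function \<open>1 - x\<close> vanishes at 1 and equals 2 at -1, which
    isolates the condition at -1. The integrand is the derivative of \<open>(1 - x) p\<close> off
    \<open>S\<close>.\<close>
  have "(LINT x|M\<Omega>. - 1 *\<^sub>R g x - (1 - x) *\<^sub>R (K x *\<^sub>R u x)) = integral {-1..1} (\<lambda>x. (1 - x) *\<^sub>R - (K x *\<^sub>R w x) + - 1 *\<^sub>R p x)"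
  proof -
    have id: "(\<lambda>x. 1 - x :: real) \<in> borel_measurable M\<Omega>"
      by (intro measurable_Omega_continuous continuous_intros)
    have "(LINT x|M\<Omega>. - 1 *\<^sub>R g x - (1 - x) *\<^sub>R (K x *\<^sub>R u x)) =
        (LINT x|M\<Omega>. (1 - x) *\<^sub>R - (K x *\<^sub>R w x) + - 1 *\<^sub>R p x)"
    proof (rule integral_cong_AE)
      show "AE x in M\<Omega>. - 1 *\<^sub>R g x - (1 - x) *\<^sub>R (K x *\<^sub>R u x) = (1 - x) *\<^sub>R - (K x *\<^sub>R w x) + - 1 *\<^sub>R p x"
        using uw gp by eventually_elim simp
    qed (use iu ig iw ip id in measurable)
    also have "\<dots> = integral {-1..1} (\<lambda>x. (1 - x) *\<^sub>R - (K x *\<^sub>R w x) + - 1 *\<^sub>R p x)"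
      by (intro LINT_Omega_eq_integral Bochner_Integration.integrable_add
          integrable_Omega_scaleR_continuous iKw ip continuous_intros)
    finally show ?thesis .
  qed
  also have "\<dots> = (1 - 1) *\<^sub>R p 1 - (1 - (-1)) *\<^sub>R p (-1)"
  proof (intro integral_unique fundamental_theorem_of_calculus_interior_strong[OF S])
    fix x assume "x \<in> {-1<..<1} - S"
    then show "((\<lambda>x. (1 - x) *\<^sub>R p x) has_vector_derivative (1 - x) *\<^sub>R - (K x *\<^sub>R w x) + - 1 *\<^sub>R p x) (at x)"
      by (intro has_vector_derivative_scaleR dp) (auto intro!: derivative_eq_intros)
  qed (auto intro!: continuous_intros p)
  finally have test: "(LINT x|M\<Omega>. - 1 *\<^sub>R g x - (1 - x) *\<^sub>R (K x *\<^sub>R u x)) = - 2 * p (-1)"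
    by (simp add: scaleR_conv_of_real)
  have bc: "- p (-1) - \<i> * of_real (\<omega> / c (-1)) * w (-1) = g1"
  proof -
    define A where "A = complex_of_real (\<omega> / c (-1))"
    have "((\<lambda>x. 1 - x) has_real_derivative - 1) (at x)" for x
      by (auto intro!: derivative_eq_intros)
    from weak_C1[OF this continuous_on_const, unfolded test]
    have "- 2 * p (-1) - \<i> * (A * w (-1) * 2) = g1 * 2"
      using tr[of "-1"] by (simp add: A_def)
    then have "2 * (- p (-1) - \<i> * A * w (-1)) = 2 * g1"
      by (simp add: algebra_simps)
    then show ?thesis unfolding A_def mult_cancel_left by simp
  qed

  \<comment> \<open>Tested with \<open>u\<close>, the volume integral is real, so the imaginary part
    retains only boundary terms.\<close>
  have "(LINT x|M\<Omega>. g x * cnj (weak_deriv u x) - of_real (K x) * u x * cnj (u x)) =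
      (LINT x|M\<Omega>. complex_of_real ((cmod (g x))\<^sup>2 - K x * (cmod (u x))\<^sup>2))"
    by (intro Bochner_Integration.integral_cong)
      (simp_all add: g_def mult.assoc flip: complex_norm_square)
  also have "\<dots> = complex_of_real (LINT x|M\<Omega>. (cmod (g x))\<^sup>2 - K x * (cmod (u x))\<^sup>2)"
    by (rule integral_complex_of_real)
  finally have "Im (LINT x|M\<Omega>. g x * cnj (weak_deriv u x) - of_real (K x) * u x * cnj (u x)) = 0"
    by (simp only: Im_complex_of_real)
  moreover have abs_sq: "of_real a * z * cnj z = complex_of_real (a * (cmod z)\<^sup>2)" for a z
    by (simp add: mult.assoc flip: complex_norm_square)
  have "(LINT x|M\<Omega>. g x * cnj (weak_deriv u x) - of_real (K x) * u x * cnj (u x)) -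
      \<i> * of_real (\<omega> / c (-1) * (cmod (w (-1)))\<^sup>2 + \<omega> / c 1 * (cmod (w 1))\<^sup>2) =
      g1 * cnj (w (-1)) + g2 * cnj (w 1)"
    using weak[OF u] tr[of "-1"] tr[of 1] unfolding abs_sq by (simp del: of_real_divide of_real_mult)
  moreover have "e = - Im z" if "L - \<i> * complex_of_real e = z" "Im L = 0" for L e z
    using that by auto
  ultimately have energy: "\<omega> / c (-1) * (cmod (w (-1)))\<^sup>2 + \<omega> / c 1 * (cmod (w 1))\<^sup>2 =
       - Im (g1 * cnj (w (-1)) + g2 * cnj (w 1))"
    by blast

  show thesis
    by (rule that[OF w p uw gp[unfolded g_def] dw dp[unfolded K_def] bc energy])
qed

subsection \<open>The stability estimate\<close>

text \<open>The energy is taken with the constant coefficient \<open>\<kappa>\<close>, hence does not jump with \<open>K\<close>;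
  its relative growth rate is at most \<open>\<kappa>\<close>.\<close>
lemma helmholtz_energy_growth:
  fixes w p :: "real \<Rightarrow> complex"
  assumes w: "continuous_on {-1..1} w" and p: "continuous_on {-1..1} p" and S: "finite S"
    and dw: "\<And>t. t \<in> Omega \<Longrightarrow> (w has_vector_derivative p t) (at t)"
    and dp: "\<And>t. t \<in> Omega - S \<Longrightarrow> (p has_vector_derivative - (K t *\<^sub>R w t)) (at t)"
    and K: "\<And>t. t \<in> Omega - S \<Longrightarrow> 0 \<le> K t \<and> K t \<le> \<kappa>\<^sup>2" and \<kappa>: "0 < \<kappa>" and x: "x \<in> {-1..1}"
  shows "(cmod (p x))\<^sup>2 + \<kappa>\<^sup>2 * (cmod (w x))\<^sup>2 \<le>
    exp (2 * \<kappa>) * ((cmod (p (-1)))\<^sup>2 + \<kappa>\<^sup>2 * (cmod (w (-1)))\<^sup>2)"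
proof -
  \<comment> \<open>The real inner product on the complex plane,
    \<open>p \<bullet> w = Re (p * cnj w)\<close>, makes the energy differentiable by the bilinear
    product rule.\<close>
  define E where "E t = p t \<bullet> p t + \<kappa>\<^sup>2 * (w t \<bullet> w t)" for t
  define E' where "E' t = 2 * (\<kappa>\<^sup>2 - K t) * (p t \<bullet> w t)" for t
  \<comment> \<open>The integrating factor turns the growth bound into monotonicity of
    \<open>F\<close>.\<close>
  define F where "F t = exp (- \<kappa> * t) * E t" for t
  have F: "((\<lambda>t. exp (- \<kappa> * t) * (E' t - \<kappa> * E t)) has_integral F x - F (-1)) {-1..x}"
  proof (rule fundamental_theorem_of_calculus_interior_strong[OF S])
    fix t assume "t \<in> {-1<..<x} - S"
    then have t: "t \<in> Omega - S" using x by auto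
    note d = dw[of t, unfolded has_vector_derivative_def] dp[OF t, unfolded has_vector_derivative_def]
    have "(E has_vector_derivative E' t) (at t)"
      unfolding E_def E'_def has_vector_derivative_def using t
      by (auto intro!: derivative_eq_intros d simp: algebra_simps inner_commute)
    then have "(E has_real_derivative E' t) (at t)"
      by (simp add: has_real_derivative_iff_has_vector_derivative)
    then have "(F has_real_derivative exp (- \<kappa> * t) * (E' t - \<kappa> * E t)) (at t)"
      unfolding F_def by (auto intro!: derivative_eq_intros simp: algebra_simps)
    then show "(F has_vector_derivative exp (- \<kappa> * t) * (E' t - \<kappa> * E t)) (at t)"
      by (simp add: has_real_derivative_iff_has_vector_derivative)
  next
    have "continuous_on {-1..x} w" "continuous_on {-1..x} p"
      using w p x by (auto intro: continuous_on_subset)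
    then show "continuous_on {-1..x} F"
      unfolding F_def E_def by (intro continuous_intros)
  qed (use x in simp)
  \<comment> \<open>Cauchy-Schwarz, then \<open>2 a b \<le> a^2 + b^2\<close> with
    \<open>a = |p|\<close> and \<open>b = \<kappa> |w|\<close>; the remaining factor is exactly
    \<kappa>.\<close>
  have neg: "exp (- \<kappa> * t) * (E' t - \<kappa> * E t) \<le> 0" if t: "t \<in> {-1<..<x} - S" for t
  proof -
    have "K t \<le> \<kappa>\<^sup>2" "0 \<le> K t" using K[of t] t x by auto
    have "E' t \<le> 2 * (\<kappa>\<^sup>2 - K t) * (norm (p t) * norm (w t))"
      unfolding E'_def using \<open>K t \<le> \<kappa>\<^sup>2\<close> norm_cauchy_schwarz[of "p t" "w t"]
      by (intro mult_left_mono) auto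
    also have "\<dots> \<le> 2 * \<kappa>\<^sup>2 * (norm (p t) * norm (w t))"
      using \<open>0 \<le> K t\<close> by (intro mult_right_mono) auto
    also have "\<dots> = \<kappa> * (2 * norm (p t) * (\<kappa> * norm (w t)))"
      by (simp add: power2_eq_square)
    also have "\<dots> \<le> \<kappa> * ((norm (p t))\<^sup>2 + (\<kappa> * norm (w t))\<^sup>2)"
      using \<kappa> sum_squares_bound[of "norm (p t)" "\<kappa> * norm (w t)"] by (intro mult_left_mono) auto
    also have "\<dots> = \<kappa> * E t"
      by (simp add: E_def power_mult_distrib power2_norm_eq_inner)
    finally show ?thesis
      by (simp add: mult_nonneg_nonpos)
  qed
  \<comment> \<open>The sign is unknown on \<open>S\<close> and at the two ends; overwriting these
    finitely many values by 0 keeps the integral.\<close>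
  have "((\<lambda>t. if t \<in> S \<union> {-1, x} then 0 else exp (- \<kappa> * t) * (E' t - \<kappa> * E t))
      has_integral F x - F (-1)) {-1..x}"
    by (rule has_integral_spike_finite[OF _ _ F, of "S \<union> {-1, x}"]) (use S in auto)
  then have "F x - F (-1) \<le> 0"
    by (rule has_integral_le[OF _ has_integral_0]) (use neg in auto)
  then have "exp (\<kappa> * x) * F x \<le> exp (\<kappa> * x) * F (-1)" by simp
  moreover have "exp (\<kappa> * x) * F x = E x"
    by (simp add: F_def mult.assoc[symmetric] flip: exp_add)
  moreover have "exp (\<kappa> * x) * F (-1) = exp (\<kappa> * (x + 1)) * E (-1)"
    by (simp add: F_def distrib_left mult.assoc[symmetric] flip: exp_add)
  ultimately have "E x \<le> exp (\<kappa> * (x + 1)) * E (-1)" by simp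
  also have "\<dots> \<le> exp (2 * \<kappa>) * E (-1)"
    using x \<kappa> by (intro mult_right_mono) (auto simp: E_def mult.commute)
  finally show ?thesis
    by (simp add: E_def power2_norm_eq_inner)
qed

text \<open>Multiplying by \<open>k\<close> and completing squares puts \<open>(k a, k b)\<close> in
  a disc around \<open>(G / 2, G / 2)\<close> of squared radius \<open>G^2 / 2\<close>. Here
  \<open>a\<close>, \<open>b\<close> stand for the moduli of the solution at the two ends and
  \<open>ka\<close>, \<open>kb\<close> for the wave numbers there.\<close>

lemma absorbing_boundary_bound:
  fixes a b k ka kb G :: real
  assumes "ka * a\<^sup>2 + kb * b\<^sup>2 \<le> G * (a + b)" "k \<le> ka" "k \<le> kb" "0 < k" "0 \<le> a" "0 \<le> G"
  shows "k * a \<le> 2 * G"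
proof -
  have "k * a\<^sup>2 + k * b\<^sup>2 \<le> G * (a + b)"
    using mult_right_mono[OF assms(2), of "a\<^sup>2"] mult_right_mono[OF assms(3), of "b\<^sup>2"] assms(1) by simp
  then have "k * (k * a\<^sup>2 + k * b\<^sup>2) \<le> k * (G * (a + b))"
    using assms(4) by (intro mult_left_mono) auto
  then have "(k * a - G / 2)\<^sup>2 + (k * b - G / 2)\<^sup>2 \<le> G\<^sup>2 / 2"
    by (simp add: power2_eq_square algebra_simps)
  then have "(k * a - G / 2)\<^sup>2 \<le> G\<^sup>2"
    using zero_le_power2[of "k * b - G / 2"] zero_le_power2[of G] by linarith
  then have "k * a - G / 2 \<le> G"
    using assms(6) power2_le_imp_le by blast
  then show ?thesis using assms(6) by simp
qed

text \<open>The right end is the first mesh point beyond \<open>t\<close>. Its index is positive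
  because the mesh starts at -1, and its predecessor lies strictly below \<open>t\<close> because
  \<open>t\<close> is off the mesh.\<close>

lemma mesh_point_in_interval:
  assumes "mesh n x" "t \<in> Omega" "t \<notin> x ` {0..n + 1}"
  shows "\<exists>j\<in>{1..n + 1}. t \<in> {x (j - 1)<..<x j}"
proof -
  define j where "j = (LEAST j. t < x j)"
  have "t < x (n + 1)" using assms by (auto simp: mesh_def)
  then have j: "t < x j" "j \<le> n + 1"
    unfolding j_def by (auto intro: LeastI Least_le)
  have "j \<noteq> 0" using j(1) assms by (auto simp: mesh_def intro: gr0I)
  then have "\<not> t < x (j - 1)"
    using not_less_Least[of "j - 1" "\<lambda>j. t < x j"] by (simp add: j_def)
  moreover have "t \<noteq> x (j - 1)" using assms(3) j(2) by auto
  ultimately show ?thesis using j \<open>j \<noteq> 0\<close> by (intro bexI[of _ j]) auto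
qed

lemma oscillating_locally_constant:
  assumes "mesh n x" "oscillating n x c0 c1 c" "t \<in> Omega" "t \<notin> x ` {0..n + 1}"
  shows "c t \<in> {c0, c1}" and "isCont c t"
proof -
  obtain j where j: "j \<in> {1..n + 1}" "t \<in> {x (j - 1)<..<x j}"
    using mesh_point_in_interval[OF assms(1,3,4)] by blast
  have eq: "c s = (if odd j then c0 else c1)" if "s \<in> {x (j - 1)<..<x j}" for s
    using assms(2) j(1) that unfolding oscillating_def by blast
  show "c t \<in> {c0, c1}" using eq[OF j(2)] by auto
  have "\<forall>\<^sub>F s in nhds t. c s = (if odd j then c0 else c1)"
    using j(2) eq by (intro eventually_nhds_in_open[THEN eventually_mono, of "{x (j - 1)<..<x j}"]) auto
  then show "isCont c t"
    by (subst isCont_cong) auto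
qed

lemma oscillating_endpoints:
  "oscillating n x c0 c1 c \<Longrightarrow> c (-1) \<in> {c0, c1} \<and> c 1 \<in> {c0, c1}"
  by (auto simp: oscillating_def)

text \<open>The coefficient enters only through its bounds and a finite exceptional set, whose size
  does not appear in the constant. The data control the energy at -1, the growth estimate carries
  this to every point, and integration finishes.\<close>

lemma weak_solution_energy_bound:
  assumes sol: "weak_solution \<omega> c g1 g2 u" and S: "finite S"
    and cont: "\<And>t. t \<in> Omega - S \<Longrightarrow> isCont c t"
    and c: "\<And>t. t \<in> Omega - S \<or> t \<in> {-1, 1} \<Longrightarrow> cmin \<le> c t \<and> c t \<le> cmax"
    and pos: "0 < cmin" "cmin \<le> cmax" "0 < \<omega>"
  shows "energy_norm \<omega> c u \<le>
    sqrt (2 * ((1 + 2 * (cmax / cmin))\<^sup>2 + 4 * (cmax / cmin)\<^sup>2)) * exp (\<omega> / cmin) *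
      max (cmod g1) (cmod g2)"
proof -
  \<comment> \<open>The largest and smallest wave numbers are \<kappa> and \<open>k\<close>, and
    \<open>r\<close> is their ratio. The boundary terms give control in terms of \<open>k\<close>,
    the energy needs \<kappa>; each exchange costs a factor \<open>r\<close>.\<close>
  define r where "r = cmax / cmin"
  define \<kappa> where "\<kappa> = \<omega> / cmin"
  define k where "k = \<omega> / cmax"
  define G where "G = max (cmod g1) (cmod g2)"
  have r: "1 \<le> r" and \<kappa>: "0 < \<kappa>" and k: "0 < k" and \<kappa>k: "\<kappa> = r * k" and G: "0 \<le> G"
    using pos by (simp_all add: r_def \<kappa>_def k_def G_def le_max_iff_disj)
  have k_le: "k \<le> \<omega> / c t \<and> \<omega> / c t \<le> \<kappa>" if "t \<in> Omega - S \<or> t \<in> {-1, 1}" for t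
    using c[OF that] pos unfolding k_def \<kappa>_def
    by (intro conjI divide_left_mono mult_pos_pos) linarith+
  have K: "0 \<le> (\<omega> / c t)\<^sup>2 \<and> (\<omega> / c t)\<^sup>2 \<le> \<kappa>\<^sup>2" if "t \<in> Omega - S" for t
    using k_le[of t] k that by (auto intro!: power_mono simp del: power_divide)
  have contK: "isCont (\<lambda>x. (\<omega> / c x)\<^sup>2) t" if "t \<in> Omega - S" for t
    using cont[OF that] c[of t] pos that by (intro continuous_intros) auto
  obtain w p where w: "continuous_on {-1..1} w" and p: "continuous_on {-1..1} p"
    and uw: "AE x in M\<Omega>. u x = w x" and gp: "AE x in M\<Omega>. weak_deriv u x = p x"
    and dw: "\<And>t. t \<in> Omega \<Longrightarrow> (w has_vector_derivative p t) (at t)"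
    and dp: "\<And>t. t \<in> Omega - S \<Longrightarrow> (p has_vector_derivative - ((\<omega> / c t)\<^sup>2 *\<^sub>R w t)) (at t)"
    and bc: "- p (-1) - \<i> * of_real (\<omega> / c (-1)) * w (-1) = g1"
    and energy: "\<omega> / c (-1) * (cmod (w (-1)))\<^sup>2 + \<omega> / c 1 * (cmod (w 1))\<^sup>2 =
       - Im (g1 * cnj (w (-1)) + g2 * cnj (w 1))"
    by (rule weak_solution_classical[OF sol S contK conjunct2[OF K]])
      (assumption, assumption, rule that)

  have "- Im (g1 * cnj (w (-1)) + g2 * cnj (w 1)) \<le> cmod (g1 * cnj (w (-1)) + g2 * cnj (w 1))"
    using abs_Im_le_cmod[of "g1 * cnj (w (-1)) + g2 * cnj (w 1)"] by linarith
  also have "\<dots> \<le> cmod g1 * cmod (w (-1)) + cmod g2 * cmod (w 1)"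
    using norm_triangle_ineq[of "g1 * cnj (w (-1))" "g2 * cnj (w 1)"] by (simp add: norm_mult)
  also have "\<dots> \<le> G * cmod (w (-1)) + G * cmod (w 1)"
    by (intro add_mono mult_right_mono) (auto simp: G_def)
  finally have "\<omega> / c (-1) * (cmod (w (-1)))\<^sup>2 + \<omega> / c 1 * (cmod (w 1))\<^sup>2 \<le> G * (cmod (w (-1)) + cmod (w 1))"
    using energy by (simp add: distrib_left)
  then have "k * cmod (w (-1)) \<le> 2 * G"
    using k_le[of "-1"] k_le[of 1] k G
    by (intro absorbing_boundary_bound[where ka = "\<omega> / c (-1)" and kb = "\<omega> / c 1" and b = "cmod (w 1)"])
      auto
  then have \<kappa>w: "\<kappa> * cmod (w (-1)) \<le> 2 * r * G"
    using mult_left_mono[of "k * cmod (w (-1))" "2 * G" r] r by (simp add: \<kappa>k mult_ac)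
  have "p (-1) = - (g1 + \<i> * of_real (\<omega> / c (-1)) * w (-1))"
    by (simp flip: bc)
  then have "cmod (p (-1)) = cmod (g1 + \<i> * of_real (\<omega> / c (-1)) * w (-1))"
    by (simp only: norm_minus_cancel)
  also have "\<dots> \<le> cmod g1 + \<bar>\<omega> / c (-1)\<bar> * cmod (w (-1))"
    using norm_triangle_ineq[of g1 "\<i> * of_real (\<omega> / c (-1)) * w (-1)"]
    by (simp add: norm_mult norm_divide del: of_real_divide)
  also have "\<dots> \<le> G + \<kappa> * cmod (w (-1))"
    using k_le[of "-1"] k by (intro add_mono mult_right_mono) (auto simp: G_def)
  finally have "cmod (p (-1)) \<le> (1 + 2 * r) * G" using \<kappa>w by (simp add: algebra_simps)
  then have "(cmod (p (-1)))\<^sup>2 \<le> ((1 + 2 * r) * G)\<^sup>2"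
    by (intro power_mono) auto
  moreover have "(\<kappa> * cmod (w (-1)))\<^sup>2 \<le> (2 * r * G)\<^sup>2"
    using \<kappa>w \<kappa> by (intro power_mono) auto
  ultimately have "(cmod (p (-1)))\<^sup>2 + (\<kappa> * cmod (w (-1)))\<^sup>2 \<le> ((1 + 2 * r) * G)\<^sup>2 + (2 * r * G)\<^sup>2"
    by (rule add_mono)
  \<comment> \<open>The two summands come from \<open>|p(-1)| \<le> (1 + 2 r) G\<close> and
    \<open>\<kappa> |w(-1)| \<le> 2 r G\<close>.\<close>
  then have E0: "(cmod (p (-1)))\<^sup>2 + \<kappa>\<^sup>2 * (cmod (w (-1)))\<^sup>2 \<le> ((1 + 2 * r)\<^sup>2 + 4 * r\<^sup>2) * G\<^sup>2"
    unfolding power_mult_distrib distrib_right[of "(1 + 2 * r)\<^sup>2"] by simp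

  define B where "B = exp (2 * \<kappa>) * (((1 + 2 * r)\<^sup>2 + 4 * r\<^sup>2) * G\<^sup>2)"
  have "0 \<le> B" by (simp add: B_def)
  have E: "(cmod (p x))\<^sup>2 + \<kappa>\<^sup>2 * (cmod (w x))\<^sup>2 \<le> B" if "x \<in> {-1..1}" for x
    unfolding B_def
    by (rule order_trans[OF helmholtz_energy_growth[OF w p S dw dp K \<kappa> that] mult_left_mono[OF E0]]) simp_all
  \<comment> \<open>Since \<open>\<omega> / c \<le> \<kappa>\<close>, the energy with constant
    weight dominates the integrand of the energy norm.\<close>
  have "AE x in M\<Omega>. (cmod (weak_deriv u x))\<^sup>2 + (\<omega> / c x)\<^sup>2 * (cmod (u x))\<^sup>2 \<le> B"
    using uw gp AE_Omega_not_in_finite[OF S] AE_space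
  proof eventually_elim
    case (elim x)
    then have "x \<in> Omega - S" "x \<in> {-1..1}" by auto
    then show ?case
      using E[of x] mult_right_mono[of "(\<omega> / c x)\<^sup>2" "\<kappa>\<^sup>2" "(cmod (w x))\<^sup>2"] K[of x] elim by simp
  qed
  then have "(LINT x|M\<Omega>. (cmod (weak_deriv u x))\<^sup>2 + (\<omega> / c x)\<^sup>2 * (cmod (u x))\<^sup>2) \<le> (LINT x|M\<Omega>. B)"
    using \<open>0 \<le> B\<close> finite_measure.integrable_const[OF finite_measure_Omega]
    by (intro integral_mono_AE') auto
  \<comment> \<open>The factor 2 is the length of \<open>Omega\<close>.\<close>
  also have "\<dots> = 2 * B"
    by (subst LINT_Omega_eq_integral) (auto intro: integrable_Omega_continuous)
  also have "\<dots> = (sqrt (2 * ((1 + 2 * r)\<^sup>2 + 4 * r\<^sup>2)) * exp \<kappa> * G)\<^sup>2"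
    by (simp add: B_def power_mult_distrib exp_double)
  finally have "energy_norm \<omega> c u \<le> sqrt ((sqrt (2 * ((1 + 2 * r)\<^sup>2 + 4 * r\<^sup>2)) * exp \<kappa> * G)\<^sup>2)"
    unfolding energy_norm_def by (rule real_sqrt_le_mono)
  also have "\<dots> = sqrt (2 * ((1 + 2 * r)\<^sup>2 + 4 * r\<^sup>2)) * exp \<kappa> * G"
    using G by (intro real_sqrt_unique) auto
  finally show ?thesis by (simp add: r_def \<kappa>_def G_def)
qed

theorem theorem22:
  fixes q :: real
  shows "\<exists>\<alpha>q Cq :: real. 0 < \<alpha>q \<and> \<alpha>q < 1 \<and>
    (\<forall>(n :: nat) (x :: nat \<Rightarrow> real) (c0 :: real) (c1 :: real) (cmin :: real) (cmax :: real)
        (c :: real \<Rightarrow> real) (\<omega>0 :: real) (\<omega> :: real).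
       1 \<le> n \<longrightarrow> mesh n x \<longrightarrow>
       cmin = min c0 c1 \<longrightarrow> cmax = max c0 c1 \<longrightarrow> 0 < cmin \<longrightarrow>
       q = (cmax - cmin) / (cmax + cmin) \<longrightarrow>
       oscillating n x c0 c1 c \<longrightarrow>
       0 < \<omega>0 \<longrightarrow> \<omega>0 \<le> \<omega> \<longrightarrow>
       (\<exists>Cstab :: real. Cstab \<le> Cq * \<alpha>q powr (- (\<omega> / cmin)) \<and>
          (\<forall>(g1 :: complex) (g2 :: complex) (u :: real \<Rightarrow> complex).
             weak_solution \<omega> c g1 g2 u \<longrightarrow>
             energy_norm \<omega> c u \<le> Cstab * max (cmod g1) (cmod g2))))"
proof -
  \<comment> \<open>The ratio \<open>cmax / cmin\<close> equals \<open>(1 + q) / (1 - q)\<close>, so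
    the constant of the energy bound is a function of \<open>q\<close> alone.\<close>
  define Cq where "Cq = sqrt (2 * ((1 + 2 * ((1 + q) / (1 - q)))\<^sup>2 + 4 * ((1 + q) / (1 - q))\<^sup>2))"
  show ?thesis
  proof (rule exI[of _ "exp (-1)"], rule exI[of _ Cq], intro conjI allI impI)
    fix n and x :: "nat \<Rightarrow> real" and c0 c1 cmin cmax c and \<omega>0 \<omega> :: real
    assume mesh: "mesh n x" and cmin: "cmin = min c0 c1" and cmax: "cmax = max c0 c1" and pos: "0 < cmin"
      and q: "q = (cmax - cmin) / (cmax + cmin)" and osc: "oscillating n x c0 c1 c"
      and \<omega>: "0 < \<omega>0" "\<omega>0 \<le> \<omega>"
    have le: "cmin \<le> cmax" using cmin cmax by auto
    have "(1 + q) / (1 - q) = cmax / cmin"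
    proof -
      have "1 + q = 2 * cmax / (cmax + cmin)" "1 - q = 2 * cmin / (cmax + cmin)"
        using pos le by (simp_all add: q field_simps)
      then show ?thesis using pos le by simp
    qed
    then have Cq: "Cq = sqrt (2 * ((1 + 2 * (cmax / cmin))\<^sup>2 + 4 * (cmax / cmin)\<^sup>2))"
      by (simp add: Cq_def)
    have range: "cmin \<le> c t \<and> c t \<le> cmax" if "t \<in> Omega - x ` {0..n + 1} \<or> t \<in> {-1, 1}" for t
      using that oscillating_locally_constant(1)[OF mesh osc, of t] oscillating_endpoints[OF osc] cmin cmax
      by auto
    show "\<exists>Cstab. Cstab \<le> Cq * exp (-1) powr (- (\<omega> / cmin)) \<and>
        (\<forall>g1 g2 u. weak_solution \<omega> c g1 g2 u \<longrightarrow> energy_norm \<omega> c u \<le> Cstab * max (cmod g1) (cmod g2))"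
    proof (intro exI conjI allI impI)
      \<comment> \<open>This fixes \<open>Cstab\<close>; the two sides are equal because
        \<open>exp (-1) powr (- s) = exp s\<close>.\<close>
      show "Cq * exp (\<omega> / cmin) \<le> Cq * exp (-1) powr (- (\<omega> / cmin))"
        by (simp add: powr_def)
      fix g1 g2 u assume "weak_solution \<omega> c g1 g2 u"
      then show "energy_norm \<omega> c u \<le> Cq * exp (\<omega> / cmin) * max (cmod g1) (cmod g2)"
        unfolding Cq using range le pos \<omega> oscillating_locally_constant(2)[OF mesh osc]
        by (intro weak_solution_energy_bound[of \<omega> c g1 g2 u "x ` {0..n + 1}"]) auto
    qed
  qed auto
qed

end
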